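(* Let $K$ be a compact convex subset of a locally convex vector space, and let $\mu,\nu \in M^+(K)$. Then $\mu \prec_c \nu$ if and only if $\mu \prec_s \nu$.
   Context: $\mathrm{C}(K)$ is the C*-algebra of continuous complex-valued functions on $K$, and $A(K)\subset \mathrm{C}(K)$ is the space of continuous affine functions on $K$. $M^+(K)$ is the set of (finite) positive regular Borel measures on $K$; write $\mu(f)=\int_K f\,d\mu$. For $\mu\in M^+(K)$, $\pi_\mu:\mathrm{C}(K)\to\mathcal{B}(L^2(\mu))$ is the multiplication representation $\pi_\mu(f)h=fh$, $1_\mu\in L^2(\mu)$ is the constant function $1$, and $L^\infty(\mu)$ is regarded as a subalgebra of $\mathcal{B}(L^2(\mu))$ acting by multiplication operators. Choquet order: $\mu\prec_c\nu$ means $\mu(f)\le\nu(f)$ for every continuous convex function $f\in \mathrm{C}(K)$ (real-valued). Strong dilation order: $\mu\prec_s\nu$ means that there is a positive linear map $\Phi:\mathrm{C}(K)\to L^\infty(\mu)$ such that $\Phi(a)=\pi_\mu(a)$ for all $a\in A(K)$ and $\nu(f)=\langle\Phi(f)1_\mu,1_\mu\rangle$ for all $f\in\mathrm{C}(K)$. *)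

theory Defs
  imports "HOL-Analysis.Analysis"
begin

section \<open>Locally convex spaces\<close>

text \<open>Hausdorff locally convex topological vector spaces. Only the real structure matters for
  convexity, so a complex space is viewed as a real one.
  The last assumption says that convex open sets form a base, with the predicate \<open>convex\<close>
  written out.\<close>

class locally_convex_space = real_vector + t2_space + topological_ab_group_add +
  assumes tendsto_scaleR_Pair:
      "LIM p (nhds r \<times>\<^sub>F nhds x). fst p *\<^sub>R snd p :> nhds (r *\<^sub>R x)"
    and ex_convex_nhd: "open U \<Longrightarrow> x \<in> U \<Longrightarrow> \<exists>V. open V \<and> x \<in> V \<and> V \<subseteq> U \<and>
      (\<forall>y\<in>V. \<forall>z\<in>V. \<forall>u\<ge>0. \<forall>v\<ge>0. u + v = 1 \<longrightarrow> u *\<^sub>R y + v *\<^sub>R z \<in> V)"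

lemma locally_convex:
  fixes U :: "'a::locally_convex_space set"
  assumes "open U" "x \<in> U"
  shows "\<exists>V. open V \<and> convex V \<and> x \<in> V \<and> V \<subseteq> U"
  using ex_convex_nhd[OF assms] by (auto simp: convex_def)

instance real_normed_vector \<subseteq> locally_convex_space
proof
  fix r :: real and x :: 'a and U :: "'a set"
  show "LIM p (nhds r \<times>\<^sub>F nhds x). fst p *\<^sub>R snd p :> nhds (r *\<^sub>R x)"
    by (intro tendsto_scaleR filterlim_fst filterlim_snd)
  assume "open U" "x \<in> U"
  then have "\<exists>V. open V \<and> convex V \<and> x \<in> V \<and> V \<subseteq> U"
    by (metis open_contains_ball open_ball convex_ball centre_in_ball)
  then show "\<exists>V. open V \<and> x \<in> V \<and> V \<subseteq> U \<and>
      (\<forall>y\<in>V. \<forall>z\<in>V. \<forall>u\<ge>0. \<forall>v\<ge>0. u + v = 1 \<longrightarrow> u *\<^sub>R y + v *\<^sub>R z \<in> V)"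
    unfolding convex_def by blast
qed


section \<open>Functions and measures on $K$\<close>

text \<open>A function on \<open>K\<close> is represented by its extension by \<open>0\<close> to the whole type, so that
  \<open>C_space K\<close> is a complex vector space under the pointwise operations and equality of its
  elements is equality on \<open>K\<close>.\<close>

definition C_space :: "'a::topological_space set \<Rightarrow> ('a \<Rightarrow> complex) set" where
  "C_space K = {f. continuous_on K f \<and> (\<forall>x. x \<notin> K \<longrightarrow> f x = 0)}"

definition A_space :: "'a::{real_vector, topological_space} set \<Rightarrow> ('a \<Rightarrow> complex) set" where
  "A_space K = {a \<in> C_space K. \<forall>x\<in>K. \<forall>y\<in>K. \<forall>u\<ge>0. \<forall>v\<ge>0. u + v = 1 \<longrightarrow>
     a (u *\<^sub>R x + v *\<^sub>R y) = u *\<^sub>R a x + v *\<^sub>R a y}"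

definition regular_borel_measures :: "'a::topological_space set \<Rightarrow> 'a measure set" where
  "regular_borel_measures K = {\<mu>. sets \<mu> = sets (restrict_space borel K) \<and> finite_measure \<mu> \<and>
     (\<forall>B\<in>sets \<mu>.
        emeasure \<mu> B = (SUP C\<in>{C. compact C \<and> C \<subseteq> B}. emeasure \<mu> C) \<and>
        emeasure \<mu> B = (INF U\<in>{U. openin (top_of_set K) U \<and> B \<subseteq> U}. emeasure \<mu> U))}"

definition choquet_le :: "'a::{real_vector, topological_space} set \<Rightarrow> 'a measure \<Rightarrow> 'a measure \<Rightarrow> bool"
  where "choquet_le K \<mu> \<nu> \<longleftrightarrow>
    (\<forall>f :: 'a \<Rightarrow> real. continuous_on K f \<and> convex_on K f \<longrightarrow> (\<integral>x. f x \<partial>\<mu>) \<le> (\<integral>x. f x \<partial>\<nu>))"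


section \<open>The Hilbert space $L^2(\mu)$ and multiplication operators\<close>

text \<open>Elements of \<open>L\<^sup>2(\<mu>)\<close> are equivalence classes of functions modulo equality almost everywhere.
  Operations on classes are computed on chosen representatives; the lemmas below record that
  the choice is irrelevant.\<close>

type_synonym 'a fun_class = "('a \<Rightarrow> complex) set"

definition ae_class :: "'a measure \<Rightarrow> ('a \<Rightarrow> complex) \<Rightarrow> 'a fun_class" where
  "ae_class \<mu> h = {g \<in> borel_measurable \<mu>. AE x in \<mu>. g x = h x}"

definition representative :: "'a fun_class \<Rightarrow> 'a \<Rightarrow> complex" where
  "representative X = (SOME h. h \<in> X)"

definition L2 :: "'a measure \<Rightarrow> 'a fun_class set" where
  "L2 \<mu> = {ae_class \<mu> h | h. h \<in> borel_measurable \<mu> \<and> integrable \<mu> (\<lambda>x. (cmod (h x))\<^sup>2)}"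

definition L2_add :: "'a measure \<Rightarrow> 'a fun_class \<Rightarrow> 'a fun_class \<Rightarrow> 'a fun_class" where
  "L2_add \<mu> X Y = ae_class \<mu> (\<lambda>x. representative X x + representative Y x)"

definition L2_scale :: "'a measure \<Rightarrow> complex \<Rightarrow> 'a fun_class \<Rightarrow> 'a fun_class" where
  "L2_scale \<mu> c X = ae_class \<mu> (\<lambda>x. c * representative X x)"

definition L2_inner :: "'a measure \<Rightarrow> 'a fun_class \<Rightarrow> 'a fun_class \<Rightarrow> complex" where
  "L2_inner \<mu> X Y = (\<integral>x. representative X x * cnj (representative Y x) \<partial>\<mu>)"

definition L2_one :: "'a measure \<Rightarrow> 'a fun_class" where
  "L2_one \<mu> = ae_class \<mu> (\<lambda>_. 1)"

text \<open>Operators on \<open>L\<^sup>2(\<mu>)\<close> are extensional functions, so that equality of operators is equality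
  on \<open>L\<^sup>2(\<mu>)\<close>.\<close>

type_synonym 'a L2_operator = "'a fun_class \<Rightarrow> 'a fun_class"

definition mult_op :: "'a measure \<Rightarrow> ('a \<Rightarrow> complex) \<Rightarrow> 'a L2_operator" where
  "mult_op \<mu> g = (\<lambda>X\<in>L2 \<mu>. ae_class \<mu> (\<lambda>x. g x * representative X x))"

definition Linfty :: "'a measure \<Rightarrow> 'a L2_operator set" where
  "Linfty \<mu> = {mult_op \<mu> g | g. g \<in> borel_measurable \<mu> \<and> (\<exists>B. AE x in \<mu>. cmod (g x) \<le> B)}"

definition op_add :: "'a measure \<Rightarrow> 'a L2_operator \<Rightarrow> 'a L2_operator \<Rightarrow> 'a L2_operator" where
  "op_add \<mu> S T = (\<lambda>X\<in>L2 \<mu>. L2_add \<mu> (S X) (T X))"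

definition op_scale :: "'a measure \<Rightarrow> complex \<Rightarrow> 'a L2_operator \<Rightarrow> 'a L2_operator" where
  "op_scale \<mu> c T = (\<lambda>X\<in>L2 \<mu>. L2_scale \<mu> c (T X))"

definition op_positive :: "'a measure \<Rightarrow> 'a L2_operator \<Rightarrow> bool" where
  "op_positive \<mu> T \<longleftrightarrow> (\<forall>X\<in>L2 \<mu>. L2_inner \<mu> (T X) X \<in> \<real>\<^sub>\<ge>\<^sub>0)"

lemma representative_ae_class:
  assumes "h \<in> borel_measurable \<mu>"
  shows "representative (ae_class \<mu> h) \<in> borel_measurable \<mu>"
    and "AE x in \<mu>. representative (ae_class \<mu> h) x = h x"
proof -
  have "h \<in> ae_class \<mu> h"
    using assms by (simp add: ae_class_def)
  then have "representative (ae_class \<mu> h) \<in> ae_class \<mu> h"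
    unfolding representative_def by (metis someI)
  then show "representative (ae_class \<mu> h) \<in> borel_measurable \<mu>"
    and "AE x in \<mu>. representative (ae_class \<mu> h) x = h x"
    by (simp_all add: ae_class_def)
qed

lemma ae_class_cong:
  assumes "AE x in \<mu>. g x = h x"
  shows "ae_class \<mu> g = ae_class \<mu> h"
proof -
  have "(AE x in \<mu>. k x = g x) \<longleftrightarrow> (AE x in \<mu>. k x = h x)" for k
    using assms by (auto elim!: eventually_elim2)
  then show ?thesis
    by (simp add: ae_class_def)
qed

lemma L2_add_ae_class:
  assumes "g \<in> borel_measurable \<mu>" "h \<in> borel_measurable \<mu>"
  shows "L2_add \<mu> (ae_class \<mu> g) (ae_class \<mu> h) = ae_class \<mu> (\<lambda>x. g x + h x)"
  unfolding L2_add_def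
  by (rule ae_class_cong)
    (use representative_ae_class(2)[OF assms(1)] representative_ae_class(2)[OF assms(2)]
      in eventually_elim, simp)

lemma L2_scale_ae_class:
  assumes "h \<in> borel_measurable \<mu>"
  shows "L2_scale \<mu> c (ae_class \<mu> h) = ae_class \<mu> (\<lambda>x. c * h x)"
  unfolding L2_scale_def
  by (rule ae_class_cong) (use representative_ae_class(2)[OF assms] in eventually_elim, simp)

lemma L2_inner_ae_class:
  assumes "g \<in> borel_measurable \<mu>" "h \<in> borel_measurable \<mu>"
  shows "L2_inner \<mu> (ae_class \<mu> g) (ae_class \<mu> h) = (\<integral>x. g x * cnj (h x) \<partial>\<mu>)"
proof -
  note [measurable] = assms representative_ae_class(1)[OF assms(1)] representative_ae_class(1)[OF assms(2)]
  have [measurable]: "cnj \<in> borel_measurable borel"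
    by (intro borel_measurable_continuous_onI continuous_intros)
  show ?thesis
    unfolding L2_inner_def
    by (rule integral_cong_AE, measurable)
      (use representative_ae_class(2)[OF assms(1)] representative_ae_class(2)[OF assms(2)]
        in eventually_elim, simp)
qed

lemma mult_op_ae_class:
  assumes "h \<in> borel_measurable \<mu>" "integrable \<mu> (\<lambda>x. (cmod (h x))\<^sup>2)"
  shows "mult_op \<mu> g (ae_class \<mu> h) = ae_class \<mu> (\<lambda>x. g x * h x)"
proof -
  have "ae_class \<mu> h \<in> L2 \<mu>"
    using assms by (auto simp: L2_def)
  moreover have "ae_class \<mu> (\<lambda>x. g x * representative (ae_class \<mu> h) x) = ae_class \<mu> (\<lambda>x. g x * h x)"
    by (rule ae_class_cong) (use representative_ae_class(2)[OF assms(1)] in eventually_elim, simp)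
  ultimately show ?thesis
    by (simp add: mult_op_def)
qed


section \<open>The strong dilation order\<close>

text \<open>Positivity of an element of \<open>L\<^sup>\<infinity>(\<mu>)\<close> is positivity as an operator on \<open>L\<^sup>2(\<mu>)\<close>, and
  \<open>\<pi>\<^sub>\<mu>\<close> is \<open>mult_op \<mu>\<close> on \<open>C_space K\<close>.\<close>

definition positive_linear_map ::
    "'a::topological_space set \<Rightarrow> 'a measure \<Rightarrow> (('a \<Rightarrow> complex) \<Rightarrow> 'a L2_operator) \<Rightarrow> bool" where
  "positive_linear_map K \<mu> \<Phi> \<longleftrightarrow>
     \<Phi> \<in> C_space K \<rightarrow> Linfty \<mu> \<and>
     (\<forall>f\<in>C_space K. \<forall>g\<in>C_space K. \<Phi> (\<lambda>x. f x + g x) = op_add \<mu> (\<Phi> f) (\<Phi> g)) \<and>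
     (\<forall>c. \<forall>f\<in>C_space K. \<Phi> (\<lambda>x. c * f x) = op_scale \<mu> c (\<Phi> f)) \<and>
     (\<forall>f\<in>C_space K. (\<forall>x\<in>K. f x \<in> \<real>\<^sub>\<ge>\<^sub>0) \<longrightarrow> op_positive \<mu> (\<Phi> f))"

definition strong_dilation_le ::
    "'a::{real_vector, topological_space} set \<Rightarrow> 'a measure \<Rightarrow> 'a measure \<Rightarrow> bool" where
  "strong_dilation_le K \<mu> \<nu> \<longleftrightarrow>
     (\<exists>\<Phi>. positive_linear_map K \<mu> \<Phi> \<and>
       (\<forall>a\<in>A_space K. \<Phi> a = mult_op \<mu> a) \<and>
       (\<forall>f\<in>C_space K. (\<integral>x. f x \<partial>\<nu>) = L2_inner \<mu> (\<Phi> f (L2_one \<mu>)) (L2_one \<mu>)))"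

end

theory Submission
  imports Defs "HOL-Probability.Discrete_Topology"
begin

text \<open>
  Both implications rest on the Mazur--Orlicz form of the Hahn--Banach theorem (\<open>mazur_orlicz\<close>), which is
  proved by showing that minimal sublinear functionals are linear.

  A strong dilation \<open>\<Phi>\<close> satisfies \<open>\<Phi>(f) \<ge> \<Phi>(a) = a\<close> almost everywhere whenever \<open>a\<close> is a continuous affine
  function below \<open>f\<close>. A continuous convex \<open>f\<close> is up to \<open>\<epsilon>\<close> a maximum of finitely many such \<open>a\<close>
  (\<open>exists_affine_below_convex\<close> and compactness), so \<open>\<Phi>(f) \<ge> f - \<epsilon>\<close> almost everywhere, and integrating
  with respect to \<open>\<mu>\<close> gives \<open>\<nu>(f) \<ge> \<mu>(f)\<close>.

  Conversely, a dilation amounts to its integrals \<open>\<beta>(B, f) = \<integral>\<^sub>B \<Phi>(f) d\<mu>\<close>, that is, to a positive linear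
  functional \<open>L(1\<^sub>B \<otimes> f) = \<beta>(B, f)\<close> on functions of two variables. It has to reproduce \<open>\<nu>\<close> on \<open>1\<^sub>K \<otimes> f\<close>
  and to satisfy \<open>L(H) \<ge> \<integral>H(x, x) d\<mu>(x)\<close> whenever \<open>H(x, \<cdot>)\<close> is convex and depends on \<open>x\<close> through finitely
  many measurable pieces. The Choquet order says exactly that these demands do not contradict each
  other: if \<open>H(x, y) \<le> f(y) + s\<close> for all \<open>x\<close> and \<open>y\<close>, then the maximum over \<open>x\<close> of the convex functions
  \<open>H(x, \<cdot>)\<close> separates \<open>H\<close> from \<open>f + s\<close> (\<open>choquet_le_simple_convex\<close>). The Mazur--Orlicz theorem therefore
  provides \<open>L\<close> (\<open>choquet_le_imp_dilation_form\<close>). Since \<open>\<beta>(\<cdot>, f)\<close> is dominated by a multiple of \<open>\<mu>\<close>, it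
  has a bounded density, and multiplication by this density is \<open>\<Phi>(f)\<close>
  (\<open>exists_positive_linear_map\<close>).
\<close>


section \<open>Sublinear functionals and the Mazur--Orlicz theorem\<close>

text \<open>Only one inequality of positive homogeneity is demanded: used for \<open>t\<close> and for \<open>1 / t\<close> it gives
  equality.\<close>

definition sublinear :: "('v::real_vector \<Rightarrow> real) \<Rightarrow> bool" where
  "sublinear p \<longleftrightarrow> (\<forall>x y. p (x + y) \<le> p x + p y) \<and> (\<forall>t>0. \<forall>x. p (t *\<^sub>R x) \<le> t * p x)"

lemma sublinearI:
  assumes "\<And>x y. p (x + y) \<le> p x + p y" and "\<And>t x. 0 < t \<Longrightarrow> p (t *\<^sub>R x) \<le> t * p x"
  shows "sublinear p"
  using assms by (simp add: sublinear_def)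

lemma sublinear_add: "sublinear p \<Longrightarrow> p (x + y) \<le> p x + p y"
  by (simp add: sublinear_def)

lemma sublinear_scaleR_pos:
  assumes "sublinear p" "0 < t"
  shows "p (t *\<^sub>R x) = t * p x"
proof (rule antisym)
  show "p (t *\<^sub>R x) \<le> t * p x"
    using assms by (simp add: sublinear_def)
  have "p (inverse t *\<^sub>R (t *\<^sub>R x)) \<le> inverse t * p (t *\<^sub>R x)"
    using assms unfolding sublinear_def by (meson positive_imp_inverse_positive)
  then show "t * p x \<le> p (t *\<^sub>R x)"
    using assms(2) by (simp add: field_simps)
qed

lemma sublinear_zero: "sublinear p \<Longrightarrow> p 0 = 0"
  using sublinear_scaleR_pos[of p 2 0] by simp

lemma sublinear_scaleR:
  assumes "sublinear p" "0 \<le> t"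
  shows "p (t *\<^sub>R x) = t * p x"
  using assms sublinear_scaleR_pos[of p t x] sublinear_zero[of p] by (cases "t = 0") auto

lemma sublinear_ge_minus: "sublinear p \<Longrightarrow> - p (- x) \<le> p x"
  using sublinear_add[of p x "- x"] sublinear_zero[of p] by simp

text \<open>A set \<open>D\<close> of pairs \<open>(w, r)\<close> lists constraints \<open>p w \<le> r\<close> on a sublinear \<open>p \<le> q\<close>. Such a \<open>p\<close> satisfies
  \<open>p v \<le> p w + p (v - w) \<le> r + q (v - w)\<close>, so the infimum below bounds it from above; for a convex
  cone of constraints compatible with \<open>q\<close> the infimum is itself sublinear, hence the largest solution.\<close>

definition inf_conv :: "('v::real_vector \<Rightarrow> real) \<Rightarrow> ('v \<times> real) set \<Rightarrow> 'v \<Rightarrow> real" where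
  "inf_conv q D v = (INF d\<in>D. snd d + q (v - fst d))"

text \<open>The values \<open>r + q (v - w)\<close> have a lower bound that depends on \<open>v\<close> only, which makes their infimum
  meaningful.\<close>

lemma inf_conv_bound:
  assumes "sublinear q" "\<forall>(w, r)\<in>D. 0 \<le> r + q (- w)" "d \<in> D"
  shows "- q (- v) \<le> snd d + q (v - fst d)"
proof -
  have "q (- fst d) \<le> q (v - fst d) + q (- v)"
    using sublinear_add[OF assms(1), of "v - fst d" "- v"] by simp
  then show ?thesis
    using assms(2,3) by (force simp: case_prod_beta)
qed

lemma inf_conv_le:
  assumes "sublinear q" "\<forall>(w, r)\<in>D. 0 \<le> r + q (- w)" "(w, r) \<in> D"
  shows "inf_conv q D v \<le> r + q (v - w)"
proof -
  have "bdd_below ((\<lambda>d. snd d + q (v - fst d)) ` D)"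
    using inf_conv_bound[OF assms(1,2)] by (intro bdd_belowI2) blast
  from cINF_lower[OF this assms(3)] show ?thesis
    by (simp add: inf_conv_def)
qed

lemma sublinear_inf_conv:
  assumes q: "sublinear q" and D: "convex_cone D"
    and pos: "\<forall>(w, r)\<in>D. 0 \<le> r + q (- w)"
  shows "sublinear (inf_conv q D)"
proof (rule sublinearI)
  note le = inf_conv_le[OF q pos]
  have ne: "D \<noteq> {}"
    using D by (rule convex_cone_nonempty)
  fix x y
  have *: "inf_conv q D (x + y) \<le> (snd d + q (x - fst d)) + (snd e + q (y - fst e))"
    if "d \<in> D" "e \<in> D" for d e
  proof -
    have "(fst d + fst e, snd d + snd e) \<in> D"
      using convex_cone_add[OF D that] by (simp add: plus_prod_def)
    then have "inf_conv q D (x + y) \<le> (snd d + snd e) + q ((x + y) - (fst d + fst e))"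
      by (rule le)
    also have "q ((x + y) - (fst d + fst e)) \<le> q (x - fst d) + q (y - fst e)"
      using sublinear_add[OF q, of "x - fst d" "y - fst e"] by (simp add: algebra_simps)
    finally show ?thesis by simp
  qed
  have "inf_conv q D (x + y) - (snd d + q (x - fst d)) \<le> inf_conv q D y" if "d \<in> D" for d
    unfolding inf_conv_def[of _ _ y] using *[OF that] by (intro cINF_greatest ne) (simp add: algebra_simps)
  then have "inf_conv q D (x + y) - inf_conv q D y \<le> inf_conv q D x"
    unfolding inf_conv_def[of _ _ x] by (intro cINF_greatest ne) (simp add: algebra_simps)
  then show "inf_conv q D (x + y) \<le> inf_conv q D x + inf_conv q D y"
    by simp
next
  note le = inf_conv_le[OF q pos]
  fix t :: real and x assume t: "0 < t"
  have "inf_conv q D (t *\<^sub>R x) / t \<le> inf_conv q D x"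
    unfolding inf_conv_def[of _ _ x]
  proof (intro cINF_greatest convex_cone_nonempty[OF D])
    fix d assume "d \<in> D"
    then have "(t *\<^sub>R fst d, t * snd d) \<in> D"
      using convex_cone_scaleR[OF D, of t d] t by (simp add: scaleR_prod_def)
    then have "inf_conv q D (t *\<^sub>R x) \<le> t * snd d + q (t *\<^sub>R x - t *\<^sub>R fst d)"
      by (rule le)
    also have "\<dots> = t * (snd d + q (x - fst d))"
      using sublinear_scaleR_pos[OF q t, of "x - fst d"] by (simp add: algebra_simps)
    finally show "inf_conv q D (t *\<^sub>R x) / t \<le> snd d + q (x - fst d)"
      using t by (simp add: field_simps)
  qed
  then show "inf_conv q D (t *\<^sub>R x) \<le> t * inf_conv q D x"
    using t by (simp add: field_simps)
qed

text \<open>Push a minimal sublinear \<open>m\<close> down along the ray spanned by \<open>- w\<close>: the functional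
  \<open>v \<mapsto> inf {m (v + t w) - t m w | t \<ge> 0}\<close> is an infimal convolution below \<open>m\<close>, so it is \<open>m\<close>, and
  \<open>t = 1\<close> yields \<open>m v \<le> m (v + w) - m w\<close>. Together with subadditivity this is additivity.\<close>

lemma minimal_sublinear_linear:
  assumes m: "sublinear m" and minimal: "\<And>m'. sublinear m' \<Longrightarrow> m' \<le> m \<Longrightarrow> m' = m"
  shows "linear m"
proof -
  have superadd: "m v + m w \<le> m (v + w)" for v w
  proof -
    \<comment> \<open>The ray is parametrised by all reals through \<open>max 0 t\<close>.\<close>
    let ?D = "range (\<lambda>t. (- (max 0 t *\<^sub>R w), - (max 0 t * m w)))"
    have D: "convex_cone ?D"
    proof -
      have "?D = (\<lambda>t. t *\<^sub>R (- w, - m w)) ` {0..}"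
        by (auto simp: image_iff scaleR_prod_def) (metis max.absorb2)
      moreover have "linear (\<lambda>t. t *\<^sub>R (- w, - m w))"
        by (rule linear_scaleR_left)
      moreover have "convex_cone {0::real..}"
        by (auto simp: convex_cone_def conic_def)
      ultimately show ?thesis
        by (simp add: convex_cone_linear_image)
    qed
    have pos: "\<forall>(u, r)\<in>?D. 0 \<le> r + m (- u)"
      using sublinear_scaleR[OF m] by auto
    have in0: "(0, 0) \<in> ?D"
      by (rule image_eqI[of _ _ 0]) auto
    have in1: "(- w, - m w) \<in> ?D"
      by (rule image_eqI[of _ _ 1]) auto
    have "inf_conv m ?D \<le> m"
      using inf_conv_le[OF m pos in0] by (auto simp: le_fun_def)
    then have "inf_conv m ?D = m"
      by (intro minimal sublinear_inf_conv m D pos)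
    then show ?thesis
      using inf_conv_le[OF m pos in1, of v] by simp
  qed
  then have add: "m (v + w) = m v + m w" for v w
    using sublinear_add[OF m, of v w] by (simp add: antisym)
  have minus: "m (- v) = - m v" for v
    using add[of v "- v"] sublinear_zero[OF m] by simp
  show ?thesis
  proof (rule linearI)
    fix t v
    show "m (t *\<^sub>R v) = t *\<^sub>R m v"
      using sublinear_scaleR[OF m, of t v] sublinear_scaleR[OF m, of "- t" v] minus[of "t *\<^sub>R v"]
      by (cases "0 \<le> t") auto
  qed (rule add)
qed

text \<open>Hahn--Banach by Zorn's lemma: all sublinear functionals below \<open>p\<close> are bounded below by
  \<open>v \<mapsto> - p (- v)\<close>, so chains have a pointwise infimum, which is again sublinear; a minimal one is
  linear.\<close>

lemma exists_linear_le_sublinear: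
  assumes p: "sublinear p"
  shows "\<exists>l. linear l \<and> l \<le> p"
proof -
  let ?A = "{m. sublinear m \<and> m \<le> p}"
  have "\<exists>m\<in>?A. \<forall>m'\<in>?A. m' \<le> m \<longrightarrow> m' = m"
  proof (rule predicate_Zorn)
    show "partial_order_on ?A (relation_of (\<lambda>a b. b \<le> a) ?A)"
      by (rule partial_order_on_relation_ofI) auto
    fix C assume C: "C \<in> Chains (relation_of (\<lambda>a b. b \<le> a) ?A)"
    have sub: "sublinear m" "m \<le> p" if "m \<in> C" for m
      using C that by (auto simp: Chains_def relation_of_def)
    have chain: "m \<le> m' \<or> m' \<le> m" if "m \<in> C" "m' \<in> C" for m m'
      using C that by (auto simp: Chains_def relation_of_def)
    show "\<exists>u\<in>?A. \<forall>a\<in>C. u \<le> a"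
    proof (cases "C = {}")
      case True
      then show ?thesis using p by auto
    next
      case ne: False
      define u where "u = (\<lambda>v. INF m\<in>C. m v)"
      have bdd: "bdd_below ((\<lambda>m. m v) ` C)" for v
      proof (rule bdd_belowI2)
        fix m assume "m \<in> C"
        then have "- p (- v) \<le> - m (- v)" "- m (- v) \<le> m v"
          using sub[of m] sublinear_ge_minus[of m v] by (auto simp: le_fun_def)
        then show "- p (- v) \<le> m v" by simp
      qed
      have le: "u v \<le> m v" if "m \<in> C" for m v
        unfolding u_def by (rule cINF_lower[OF bdd that])
      have "sublinear u"
      proof (rule sublinearI)
        fix x y
        have *: "u (x + y) \<le> m x + m' y" if mm': "m \<in> C" "m' \<in> C" for m m'
        proof -
          obtain k where k: "k \<in> C" "k \<le> m" "k \<le> m'"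
            using chain[OF mm'] mm' by blast
          have "u (x + y) \<le> k x + k y"
            using le[OF k(1), of "x + y"] sublinear_add[OF sub(1)[OF k(1)], of x y] by simp
          also have "\<dots> \<le> m x + m' y"
            using k by (auto simp: le_fun_def intro: add_mono)
          finally show ?thesis .
        qed
        have "u (x + y) - m x \<le> u y" if "m \<in> C" for m
          unfolding u_def[THEN fun_cong, of y] using *[OF that] by (intro cINF_greatest ne) (simp add: algebra_simps)
        then have "u (x + y) - u y \<le> u x"
          unfolding u_def[THEN fun_cong, of x] by (intro cINF_greatest ne) (simp add: algebra_simps)
        then show "u (x + y) \<le> u x + u y" by simp
      next
        fix t :: real and x assume t: "0 < t"
        have "u (t *\<^sub>R x) / t \<le> u x"
          unfolding u_def[THEN fun_cong, of x]
        proof (intro cINF_greatest ne)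
          fix m assume "m \<in> C"
          then show "u (t *\<^sub>R x) / t \<le> m x"
            using le[of m "t *\<^sub>R x"] sublinear_scaleR_pos[OF sub(1) t, of m x] t
            by (simp add: field_simps)
        qed
        then show "u (t *\<^sub>R x) \<le> t * u x"
          using t by (simp add: field_simps)
      qed
      moreover have "u \<le> p"
      proof -
        obtain m where "m \<in> C" using ne by blast
        then show ?thesis
          using le[of m] sub(2)[of m] by (auto simp: le_fun_def intro: order_trans)
      qed
      ultimately show ?thesis
        using le by (auto simp: le_fun_def)
    qed
  qed
  then obtain m where m: "sublinear m" "m \<le> p"
    and min: "\<And>m'. sublinear m' \<Longrightarrow> m' \<le> p \<Longrightarrow> m' \<le> m \<Longrightarrow> m' = m"
    by blast
  have "linear m"
    using m min by (intro minimal_sublinear_linear) (auto intro: order_trans)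
  then show ?thesis
    using m by blast
qed

text \<open>The one form of the Hahn--Banach theorem from which both separation arguments below are read off:
  constraints \<open>l w \<le> r\<close> and \<open>l \<le> q\<close> can be met together by a linear \<open>l\<close> as soon as no single constraint
  contradicts the bound \<open>- l w \<le> q (- w)\<close>.\<close>

theorem mazur_orlicz:
  assumes q: "sublinear q" and D: "convex_cone D"
    and pos: "\<forall>(w, r)\<in>D. 0 \<le> r + q (- w)"
  obtains l where "linear l" "\<And>v. l v \<le> q v" "\<And>w r. (w, r) \<in> D \<Longrightarrow> l w \<le> r"
proof -
  obtain l where l: "linear l" "l \<le> inf_conv q D"
    using exists_linear_le_sublinear[OF sublinear_inf_conv[OF q D pos]] by blast
  have le: "l v \<le> r + q (v - w)" if "(w, r) \<in> D" for v w r
    using l(2) inf_conv_le[OF q pos that, of v] by (auto simp: le_fun_def intro: order_trans)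
  have "(0, 0) \<in> D"
    using convex_cone_contains_0[OF D] by (simp add: zero_prod_def)
  show thesis
  proof (rule that[OF l(1)])
    show "l v \<le> q v" for v
      using le[of 0 0 v] \<open>(0, 0) \<in> D\<close> by simp
    show "l w \<le> r" if "(w, r) \<in> D" for w r
      using le[OF that, of w] sublinear_zero[OF q] by simp
  qed
qed


section \<open>Affine minorants of continuous convex functions\<close>

lemma tendsto_scaleR_locally_convex:
  fixes g :: "'b \<Rightarrow> 'a::locally_convex_space"
  assumes "(f \<longlongrightarrow> r) F" "(g \<longlongrightarrow> x) F"
  shows "((\<lambda>z. f z *\<^sub>R g z) \<longlongrightarrow> r *\<^sub>R x) F"
  using filterlim_compose[OF tendsto_scaleR_Pair filterlim_Pair[OF assms]] by simp

definition minkowski_functional :: "'a::real_vector set \<Rightarrow> 'a \<Rightarrow> real" where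
  "minkowski_functional U v = Inf {t. 0 < t \<and> inverse t *\<^sub>R v \<in> U}"

lemma minkowski_functional_le:
  "0 < t \<Longrightarrow> inverse t *\<^sub>R v \<in> U \<Longrightarrow> minkowski_functional U v \<le> t"
  unfolding minkowski_functional_def by (rule cInf_lower) (auto intro: bdd_belowI[of _ 0])

context
  fixes U :: "'a::locally_convex_space set"
  assumes U: "open U" "convex U" "0 \<in> U"
begin

lemma minkowski_functional_ne: "{t. 0 < t \<and> inverse t *\<^sub>R v \<in> U} \<noteq> {}"
proof -
  have "((\<lambda>t. t *\<^sub>R v) \<longlongrightarrow> 0 *\<^sub>R v) (at_right 0)"
    by (intro tendsto_scaleR_locally_convex tendsto_const tendsto_ident_at)
  then have "\<forall>\<^sub>F t in at_right 0. t *\<^sub>R v \<in> U"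
    using U by (auto elim: topological_tendstoD)
  moreover have "\<forall>\<^sub>F t in at_right (0::real). 0 < t"
    by (rule eventually_at_right_less)
  ultimately have "\<forall>\<^sub>F t in at_right 0. 0 < t \<and> t *\<^sub>R v \<in> U"
    by eventually_elim simp
  then obtain t where "0 < t" "t *\<^sub>R v \<in> U"
    using eventually_happens' trivial_limit_at_right_real by blast
  then have "inverse t \<in> {t. 0 < t \<and> inverse t *\<^sub>R v \<in> U}"
    by simp
  then show ?thesis by blast
qed

lemma minkowski_functional_nonneg: "0 \<le> minkowski_functional U v"
  unfolding minkowski_functional_def by (rule cInf_greatest[OF minkowski_functional_ne]) auto

lemma minkowski_functional_ge_1:
  assumes "v \<notin> U"
  shows "1 \<le> minkowski_functional U v"
  unfolding minkowski_functional_def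
proof (rule cInf_greatest[OF minkowski_functional_ne])
  fix t assume t: "t \<in> {t. 0 < t \<and> inverse t *\<^sub>R v \<in> U}"
  show "1 \<le> t"
  proof (rule ccontr)
    assume "\<not> 1 \<le> t"
    then have "t *\<^sub>R (inverse t *\<^sub>R v) + (1 - t) *\<^sub>R 0 \<in> U"
      using t U by (intro convexD) auto
    then show False
      using t assms by simp
  qed
qed

lemma sublinear_minkowski_functional: "sublinear (minkowski_functional U)"
proof (rule sublinearI)
  fix v w
  have *: "minkowski_functional U (v + w) \<le> s + t"
    if st: "0 < s" "inverse s *\<^sub>R v \<in> U" "0 < t" "inverse t *\<^sub>R w \<in> U" for s t
  proof (rule minkowski_functional_le)
    have "(s / (s + t)) *\<^sub>R (inverse s *\<^sub>R v) + (t / (s + t)) *\<^sub>R (inverse t *\<^sub>R w) \<in> U"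
      using st U(2) by (intro convexD) (auto simp flip: add_divide_distrib)
    moreover have "(s / (s + t)) *\<^sub>R (inverse s *\<^sub>R v) = inverse (s + t) *\<^sub>R v"
      "(t / (s + t)) *\<^sub>R (inverse t *\<^sub>R w) = inverse (s + t) *\<^sub>R w"
      using st by (simp_all add: divide_inverse)
    ultimately show "inverse (s + t) *\<^sub>R (v + w) \<in> U"
      by (simp only: scaleR_add_right)
  qed (use st in simp)
  have "minkowski_functional U (v + w) - s \<le> minkowski_functional U w"
    if "0 < s" "inverse s *\<^sub>R v \<in> U" for s
    unfolding minkowski_functional_def[of U w]
    by (rule cInf_greatest[OF minkowski_functional_ne]) (use *[OF that] in \<open>force simp: algebra_simps\<close>)
  then have "minkowski_functional U (v + w) - minkowski_functional U w \<le> minkowski_functional U v"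
    unfolding minkowski_functional_def[of U v]
    by (intro cInf_greatest[OF minkowski_functional_ne]) (force simp: algebra_simps)
  then show "minkowski_functional U (v + w) \<le> minkowski_functional U v + minkowski_functional U w"
    by simp
next
  fix t :: real and v assume t: "0 < t"
  have "minkowski_functional U (t *\<^sub>R v) / t \<le> minkowski_functional U v"
    unfolding minkowski_functional_def[of U v]
  proof (rule cInf_greatest[OF minkowski_functional_ne])
    fix s assume "s \<in> {s. 0 < s \<and> inverse s *\<^sub>R v \<in> U}"
    then have "minkowski_functional U (t *\<^sub>R v) \<le> t * s"
      using t by (intro minkowski_functional_le) (auto simp: field_simps)
    then show "minkowski_functional U (t *\<^sub>R v) / t \<le> s"
      using t by (simp add: field_simps)
  qed
  then show "minkowski_functional U (t *\<^sub>R v) \<le> t * minkowski_functional U v"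
    using t by (simp add: field_simps)
qed

text \<open>On the neighbourhood \<open>z + c U\<close> of \<open>z\<close> the functional exceeds \<open>l z\<close> by at most \<open>M c\<close>; the reflected
  neighbourhood \<open>z - c U\<close> gives the bound from the other side.\<close>

lemma continuous_if_le_minkowski_functional:
  assumes l: "linear l" and M: "0 < M" and le: "\<And>v. l v \<le> M * minkowski_functional U v"
  shows "continuous_on UNIV (l :: 'a \<Rightarrow> real)"
proof -
  have "(l \<longlongrightarrow> l z) (at z)" for z
  proof (rule tendstoI)
    fix e :: real assume e: "0 < e"
    define c where "c = e / (2 * M)"
    have c: "0 < c" using e M by (simp add: c_def)
    have small: "l v < e" if "inverse c *\<^sub>R v \<in> U" for v
    proof -
      have "l v \<le> M * c"
        using le[of v] minkowski_functional_le[OF c that] M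
        by (meson mult_left_mono order_trans less_imp_le)
      then show ?thesis
        using e M by (simp add: c_def)
    qed
    have ev: "\<forall>\<^sub>F x in at z. g x \<in> U" if "(g \<longlongrightarrow> inverse c *\<^sub>R (z - z)) (at z)" for g
      using topological_tendstoD[OF that U(1)] U(3) by simp
    have "\<forall>\<^sub>F x in at z. inverse c *\<^sub>R (x - z) \<in> U"
      by (intro ev tendsto_scaleR_locally_convex tendsto_const tendsto_diff tendsto_ident_at)
    moreover have "\<forall>\<^sub>F x in at z. inverse c *\<^sub>R (z - x) \<in> U"
      by (intro ev tendsto_scaleR_locally_convex tendsto_const tendsto_diff tendsto_ident_at)
    ultimately show "\<forall>\<^sub>F x in at z. dist (l x) (l z) < e"
    proof eventually_elim
      case (elim x)
      then show ?case
        using small[of "x - z"] small[of "z - x"] linear_diff[OF l] by (simp add: dist_real_def)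
    qed
  qed
  then show ?thesis
    by (simp add: continuous_on_def)
qed

end

text \<open>A continuous convex function on a compact set is approximated from below at every point by
  continuous affine functions. The linear part is sought below \<open>M\<close> times the Minkowski functional of a
  neighbourhood \<open>U\<close> of \<open>0\<close>, which forces continuity, and below \<open>f y - c\<close> at every \<open>y - x0\<close>. The two
  demands are compatible: near \<open>x0\<close> the function \<open>f\<close> stays above \<open>c\<close> by continuity, and away from
  \<open>x0\<close> the Minkowski functional is at least \<open>1\<close>, so a large \<open>M\<close> compensates the minimum of \<open>f\<close>.\<close>

lemma exists_affine_below_convex:
  fixes f :: "'a::locally_convex_space \<Rightarrow> real"
  assumes K: "compact K" and f: "continuous_on K f" "convex_on K f"
    and x0: "x0 \<in> K" and c: "c < f x0"
  obtains l where "linear l" "continuous_on UNIV l" "\<And>y. y \<in> K \<Longrightarrow> c + l (y - x0) \<le> f y"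
proof -
  have "bdd_below (f ` K)"
    using compact_continuous_image[OF f(1) K] by (simp add: bounded_imp_bdd_below compact_imp_bounded)
  then obtain m where m: "\<And>y. y \<in> K \<Longrightarrow> m \<le> f y"
    unfolding bdd_below_def by auto
  obtain W where W: "open W" "W \<inter> K = f -` {c<..} \<inter> K"
    using f(1) open_greaterThan[of c] unfolding continuous_on_open_invariant by blast
  have "x0 \<in> W"
    using W(2) x0 c by auto
  have "continuous_on UNIV (\<lambda>u. x0 - u)"
    by (intro continuous_intros)
  then have "open ((\<lambda>u. x0 - u) -` W)"
    using W(1) by (simp add: continuous_on_open_vimage)
  then obtain U where U: "open U" "convex U" "0 \<in> U" "U \<subseteq> (\<lambda>u. x0 - u) -` W"
    using locally_convex[of "(\<lambda>u. x0 - u) -` W" 0] \<open>x0 \<in> W\<close> by auto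
  have above: "c < f y" if "y \<in> K" "x0 - y \<in> U" for y
  proof -
    have "x0 - (x0 - y) \<in> W"
      using that(2) U(4) by blast
    then have "y \<in> W \<inter> K"
      using that(1) by simp
    then show ?thesis
      unfolding W(2) by simp
  qed
  \<comment> \<open>Outside \<open>x0 - U\<close> one needs \<open>f y - c + M \<ge> 0\<close>, which \<open>M \<ge> c - m\<close> ensures.\<close>
  define M where "M = max 1 (c - m)"
  define q where "q = (\<lambda>v. M * minkowski_functional U v)"
  have M: "0 < M" by (simp add: M_def)
  note mink = sublinear_minkowski_functional[OF U(1-3)]
  have q: "sublinear q"
    unfolding q_def
  proof (rule sublinearI)
    fix v w :: 'a and t :: real
    show "M * minkowski_functional U (v + w) \<le> M * minkowski_functional U v + M * minkowski_functional U w"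
      using mult_left_mono[OF sublinear_add[OF mink, of v w], of M] M by (simp add: distrib_left)
    show "M * minkowski_functional U (t *\<^sub>R v) \<le> t * (M * minkowski_functional U v)" if "0 < t"
      using sublinear_scaleR_pos[OF mink that, of v] by simp
  qed
  \<comment> \<open>The cone over the epigraph of \<open>f - c\<close>, moved so that \<open>x0\<close> becomes the origin.\<close>
  define D where "D = {(s *\<^sub>R (y - x0), r) | s y r. 0 \<le> s \<and> y \<in> K \<and> s * (f y - c) \<le> r}"
  have conv: "f (s *\<^sub>R y + t *\<^sub>R z) \<le> s * f y + t * f z"
    if "y \<in> K" "z \<in> K" "0 \<le> s" "0 \<le> t" "s + t = 1" for s t y z
    using f(2) that unfolding convex_on_def by blast
  have D: "convex_cone D"
    unfolding convex_cone_iff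
  proof (intro conjI ballI allI impI)
    show "0 \<in> D"
      unfolding D_def using x0 by (force simp: zero_prod_def)
  next
    fix d e assume "d \<in> D" "e \<in> D"
    then obtain s y r t z r' where d: "d = (s *\<^sub>R (y - x0), r)" "0 \<le> s" "y \<in> K" "s * (f y - c) \<le> r"
      and e: "e = (t *\<^sub>R (z - x0), r')" "0 \<le> t" "z \<in> K" "t * (f z - c) \<le> r'"
      unfolding D_def by blast
    show "d + e \<in> D"
    proof (cases "s + t = 0")
      case True
      then have "s = 0" "t = 0" using d e by auto
      then have "d + e = (0 *\<^sub>R (x0 - x0), r + r')" "0 \<le> r + r'"
        using d e by auto
      then show ?thesis
        unfolding D_def using x0 by fastforce
    next
      case False
      then have pos: "0 < s + t" using d e by simp
      define u where "u = (s / (s + t)) *\<^sub>R y + (t / (s + t)) *\<^sub>R z"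
      have *: "s / (s + t) + t / (s + t) = 1"
        using pos by (simp flip: add_divide_distrib)
      have "f u \<le> (s / (s + t)) * f y + (t / (s + t)) * f z"
        unfolding u_def using d(2,3) e(2,3) pos * by (intro conv) auto
      also have "\<dots> = (s * f y + t * f z) / (s + t)"
        by (simp add: add_divide_distrib)
      finally have "(s + t) * f u \<le> s * f y + t * f z"
        using pos by (simp add: pos_le_divide_eq mult.commute)
      then have "(s + t) * (f u - c) \<le> r + r'"
        using d(4) e(4) by (simp add: algebra_simps)
      moreover have "u \<in> K"
        unfolding u_def using d e pos * convex_on_imp_convex[OF f(2)] by (intro convexD) auto
      moreover have "(s + t) *\<^sub>R u = s *\<^sub>R y + t *\<^sub>R z"
        unfolding u_def using pos by (simp add: scaleR_add_right)
      then have "d + e = ((s + t) *\<^sub>R (u - x0), r + r')"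
        using d e by (simp add: algebra_simps)
      ultimately show ?thesis
        unfolding D_def using pos by force
    qed
  next
    fix d and t :: real assume "d \<in> D" "0 \<le> t"
    then obtain s y r where d: "d = (s *\<^sub>R (y - x0), r)" "0 \<le> s" "y \<in> K" "s * (f y - c) \<le> r"
      unfolding D_def by blast
    have "t * (s * (f y - c)) \<le> t * r"
      using d(4) \<open>0 \<le> t\<close> by (rule mult_left_mono)
    then have "t *\<^sub>R d = ((t * s) *\<^sub>R (y - x0), t * r) \<and> 0 \<le> t * s \<and> y \<in> K \<and> (t * s) * (f y - c) \<le> t * r"
      using d \<open>0 \<le> t\<close> by (simp add: mult.assoc)
    then show "t *\<^sub>R d \<in> D"
      unfolding D_def by blast
  qed
  have pos: "\<forall>(w, r)\<in>D. 0 \<le> r + q (- w)"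
  proof clarify
    fix w r assume "(w, r) \<in> D"
    then obtain s y where d: "w = s *\<^sub>R (y - x0)" "0 \<le> s" "y \<in> K" "s * (f y - c) \<le> r"
      unfolding D_def by blast
    have "- q (x0 - y) \<le> f y - c"
    proof (cases "x0 - y \<in> U")
      case True
      then show ?thesis
        using above[OF d(3)] minkowski_functional_nonneg[OF U(1-3), of "x0 - y"] M
        unfolding q_def by (smt (verit) mult_nonneg_nonneg)
    next
      case False
      then have "M * 1 \<le> q (x0 - y)"
        unfolding q_def using M minkowski_functional_ge_1[OF U(1-3)] by (intro mult_left_mono) auto
      then show ?thesis
        using m[OF d(3)] unfolding M_def by simp
    qed
    then have "s * - q (x0 - y) \<le> r"
      using d(2,4) by (meson mult_left_mono order_trans)
    moreover have "q (- w) = s * q (x0 - y)"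
      using sublinear_scaleR[OF q d(2), of "x0 - y"] d(1) by (simp add: scaleR_diff_right)
    ultimately show "0 \<le> r + q (- w)"
      by simp
  qed
  obtain l where l: "linear l" "\<And>v. l v \<le> q v" "\<And>w r. (w, r) \<in> D \<Longrightarrow> l w \<le> r"
    using mazur_orlicz[OF q D pos] by blast
  show thesis
  proof (rule that[OF l(1)])
    show "continuous_on UNIV l"
      using continuous_if_le_minkowski_functional[OF U(1-3) l(1) M] l(2) unfolding q_def by blast
    show "c + l (y - x0) \<le> f y" if "y \<in> K" for y
    proof -
      have "(y - x0, f y - c) \<in> D"
        unfolding D_def using that by (intro CollectI exI[of _ 1] exI[of _ y] exI[of _ "f y - c"]) simp
      from l(3)[OF this] show ?thesis
        by simp
    qed
  qed
qed


section \<open>Multiplication operators\<close>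

lemma L2E:
  assumes "X \<in> L2 \<mu>"
  obtains k where "X = ae_class \<mu> k" "k \<in> borel_measurable \<mu>" "integrable \<mu> (\<lambda>x. (cmod (k x))\<^sup>2)"
  using assms by (auto simp: L2_def)

lemma mult_op_cong_AE:
  assumes "AE x in \<mu>. g x = h x"
  shows "mult_op \<mu> g = mult_op \<mu> h"
  unfolding mult_op_def
  by (intro restrict_ext ae_class_cong) (use assms in eventually_elim, simp)

lemma op_add_mult_op:
  assumes [measurable]: "g \<in> borel_measurable \<mu>" "h \<in> borel_measurable \<mu>"
  shows "op_add \<mu> (mult_op \<mu> g) (mult_op \<mu> h) = mult_op \<mu> (\<lambda>x. g x + h x)"
  unfolding op_add_def
proof (rule ext)
  fix X
  show "(\<lambda>X\<in>L2 \<mu>. L2_add \<mu> (mult_op \<mu> g X) (mult_op \<mu> h X)) X = mult_op \<mu> (\<lambda>x. g x + h x) X"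
  proof (cases "X \<in> L2 \<mu>")
    case True
    then obtain k where k[measurable]: "k \<in> borel_measurable \<mu>"
      and X: "X = ae_class \<mu> k" "integrable \<mu> (\<lambda>x. (cmod (k x))\<^sup>2)"
      by (elim L2E)
    have "L2_add \<mu> (mult_op \<mu> g X) (mult_op \<mu> h X) = ae_class \<mu> (\<lambda>x. g x * k x + h x * k x)"
      unfolding X(1) mult_op_ae_class[OF k X(2)] by (rule L2_add_ae_class) measurable
    also have "\<dots> = mult_op \<mu> (\<lambda>x. g x + h x) X"
      unfolding X(1) mult_op_ae_class[OF k X(2)] by (simp add: distrib_right)
    finally show ?thesis
      using True by simp
  qed (simp add: mult_op_def)
qed

lemma op_scale_mult_op:
  assumes [measurable]: "g \<in> borel_measurable \<mu>"
  shows "op_scale \<mu> c (mult_op \<mu> g) = mult_op \<mu> (\<lambda>x. c * g x)"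
  unfolding op_scale_def
proof (rule ext)
  fix X
  show "(\<lambda>X\<in>L2 \<mu>. L2_scale \<mu> c (mult_op \<mu> g X)) X = mult_op \<mu> (\<lambda>x. c * g x) X"
  proof (cases "X \<in> L2 \<mu>")
    case True
    then obtain k where k[measurable]: "k \<in> borel_measurable \<mu>"
      and X: "X = ae_class \<mu> k" "integrable \<mu> (\<lambda>x. (cmod (k x))\<^sup>2)"
      by (elim L2E)
    have "L2_scale \<mu> c (mult_op \<mu> g X) = ae_class \<mu> (\<lambda>x. c * (g x * k x))"
      unfolding X(1) mult_op_ae_class[OF k X(2)] by (rule L2_scale_ae_class) measurable
    also have "\<dots> = mult_op \<mu> (\<lambda>x. c * g x) X"
      unfolding X(1) mult_op_ae_class[OF k X(2)] by (simp add: mult.assoc)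
    finally show ?thesis
      using True by simp
  qed (simp add: mult_op_def)
qed

lemma L2_inner_mult_op:
  assumes [measurable]: "g \<in> borel_measurable \<mu>"
    and k[measurable]: "k \<in> borel_measurable \<mu>" "integrable \<mu> (\<lambda>x. (cmod (k x))\<^sup>2)"
  shows "L2_inner \<mu> (mult_op \<mu> g (ae_class \<mu> k)) (ae_class \<mu> k) = (\<integral>x. g x * of_real ((cmod (k x))\<^sup>2) \<partial>\<mu>)"
proof -
  have "L2_inner \<mu> (mult_op \<mu> g (ae_class \<mu> k)) (ae_class \<mu> k) = (\<integral>x. (g x * k x) * cnj (k x) \<partial>\<mu>)"
    unfolding mult_op_ae_class[OF k] by (rule L2_inner_ae_class) measurable
  then show ?thesis
    by (simp only: complex_norm_square mult.assoc)
qed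

lemma op_positive_mult_opI:
  assumes [measurable]: "g \<in> borel_measurable \<mu>" and pos: "AE x in \<mu>. g x \<in> \<real>\<^sub>\<ge>\<^sub>0"
  shows "op_positive \<mu> (mult_op \<mu> g)"
  unfolding op_positive_def
proof
  fix X assume "X \<in> L2 \<mu>"
  then obtain k where X: "X = ae_class \<mu> k"
    and k[measurable]: "k \<in> borel_measurable \<mu>" "integrable \<mu> (\<lambda>x. (cmod (k x))\<^sup>2)"
    by (elim L2E)
  have "L2_inner \<mu> (mult_op \<mu> g X) X = (\<integral>x. g x * of_real ((cmod (k x))\<^sup>2) \<partial>\<mu>)"
    unfolding X by (rule L2_inner_mult_op) (use k in measurable)
  also have "\<dots> = (\<integral>x. of_real (\<bar>Re (g x)\<bar> * (cmod (k x))\<^sup>2) \<partial>\<mu>)"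
    by (rule integral_cong_AE, measurable)
      (use pos in eventually_elim, auto elim!: nonneg_Reals_cases)
  also have "\<dots> = of_real (\<integral>x. \<bar>Re (g x)\<bar> * (cmod (k x))\<^sup>2 \<partial>\<mu>)"
    by (rule integral_complex_of_real)
  finally show "L2_inner \<mu> (mult_op \<mu> g X) X \<in> \<real>\<^sub>\<ge>\<^sub>0"
    by (simp add: Bochner_Integration.integral_nonneg)
qed

text \<open>Testing the operator on the class of an indicator \<open>1\<^sub>A\<close> gives the integral of \<open>g\<close> over \<open>A\<close>. If all
  averages of \<open>g\<close> lie in a closed set, then so do almost all of its values.\<close>

lemma (in finite_measure) op_positive_mult_opD:
  assumes g: "integrable M g" and pos: "op_positive M (mult_op M g)"
  shows "AE x in M. g x \<in> \<real>\<^sub>\<ge>\<^sub>0"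
proof (rule averaging_theorem[OF g])
  fix A assume A[measurable]: "A \<in> sets M"
  let ?k = "\<lambda>x. indicator A x :: complex"
  have k: "?k \<in> borel_measurable M" "integrable M (\<lambda>x. (cmod (?k x))\<^sup>2)"
    by (auto intro!: integrable_const_bound[of _ 1] simp: indicator_def)
  then have "ae_class M ?k \<in> L2 M"
    by (auto simp: L2_def)
  then have "L2_inner M (mult_op M g (ae_class M ?k)) (ae_class M ?k) \<in> \<real>\<^sub>\<ge>\<^sub>0"
    using pos by (simp add: op_positive_def)
  also have "L2_inner M (mult_op M g (ae_class M ?k)) (ae_class M ?k) = set_lebesgue_integral M A g"
    unfolding set_lebesgue_integral_def L2_inner_mult_op[OF borel_measurable_integrable[OF g] k]
    by (rule Bochner_Integration.integral_cong) (auto simp: indicator_def)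
  finally show "(1 / measure M A) *\<^sub>R set_lebesgue_integral M A g \<in> \<real>\<^sub>\<ge>\<^sub>0"
    by (auto simp: complex_nonneg_Reals_iff)
qed (rule closed_nonneg_Reals_complex)

lemma (in finite_measure) L2_inner_mult_op_one:
  assumes "g \<in> borel_measurable M"
  shows "L2_inner M (mult_op M g (L2_one M)) (L2_one M) = (\<integral>x. g x \<partial>M)"
  using L2_inner_mult_op[OF assms, of "\<lambda>_. 1"] by (simp add: L2_one_def)


section \<open>Finite Borel measures on a compact set\<close>

locale compact_borel_measure = finite_measure M for M :: "'a::topological_space measure" +
  fixes K :: "'a set"
  assumes compact_K: "compact K" and sets_eq: "sets M = sets (restrict_space borel K)"
begin

lemma space_eq: "space M = K"
  using sets_eq_imp_space_eq[OF sets_eq] by (simp add: space_restrict_space)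

lemma borel_measurable_continuous: "continuous_on K f \<Longrightarrow> f \<in> borel_measurable M"
  using borel_measurable_continuous_on_restrict measurable_cong_sets[OF sets_eq refl] by blast

lemma integrable_bounded:
  fixes f :: "'a \<Rightarrow> 'b::{banach, second_countable_topology}"
  assumes "f \<in> borel_measurable M" "\<And>x. x \<in> K \<Longrightarrow> norm (f x) \<le> B"
  shows "integrable M f"
  using assms space_eq by (intro integrable_const_bound[of f B]) auto

lemma continuous_bounded:
  fixes f :: "'a \<Rightarrow> 'b::real_normed_vector"
  assumes "continuous_on K f"
  obtains B where "0 \<le> B" "\<And>x. x \<in> K \<Longrightarrow> norm (f x) \<le> B"
proof -
  have "bounded (f ` K)"
    using compact_continuous_image[OF assms compact_K] by (rule compact_imp_bounded)
  then show thesis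
    using that by (auto simp: bounded_pos intro: less_imp_le)
qed

lemma integrable_continuous:
  fixes f :: "'a \<Rightarrow> 'b::{banach, second_countable_topology}"
  assumes "continuous_on K f"
  shows "integrable M f"
  using continuous_bounded[OF assms] integrable_bounded[OF borel_measurable_continuous[OF assms]]
  by metis

end

lemma compact_borel_measureI:
  "compact K \<Longrightarrow> \<mu> \<in> regular_borel_measures K \<Longrightarrow> compact_borel_measure \<mu> K"
  by (auto simp: regular_borel_measures_def compact_borel_measure_def compact_borel_measure_axioms_def)

text \<open>Passage from a real function on \<open>K\<close> to the element of \<open>C_space K\<close> that it determines.\<close>

definition zero_ext :: "'a set \<Rightarrow> ('a \<Rightarrow> real) \<Rightarrow> 'a \<Rightarrow> complex" where
  "zero_ext K f x = (if x \<in> K then of_real (f x) else 0)"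

lemma zero_ext_in_C_space: "continuous_on K f \<Longrightarrow> zero_ext K f \<in> C_space K"
  unfolding C_space_def
  by (auto simp: zero_ext_def intro: continuous_on_eq[of _ "\<lambda>x. of_real (f x)"] continuous_intros)

lemma (in compact_borel_measure) integral_zero_ext:
  "(\<integral>x. zero_ext K f x \<partial>M) = of_real (\<integral>x. f x \<partial>M)"
proof -
  have "(\<integral>x. zero_ext K f x \<partial>M) = (\<integral>x. complex_of_real (f x) \<partial>M)"
    by (rule Bochner_Integration.integral_cong) (auto simp: zero_ext_def space_eq)
  then show ?thesis
    by simp
qed

lemma zero_ext_in_A_space:
  assumes K: "convex K" and l: "linear l" "continuous_on K (\<lambda>x. c + l (x - x0))"
  shows "zero_ext K (\<lambda>x. c + l (x - x0)) \<in> A_space K"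
  unfolding A_space_def
proof (intro CollectI conjI ballI allI impI)
  show "zero_ext K (\<lambda>x. c + l (x - x0)) \<in> C_space K"
    by (rule zero_ext_in_C_space[OF l(2)])
  fix x y and u v :: real
  assume xy: "x \<in> K" "y \<in> K" and uv: "0 \<le> u" "0 \<le> v" "u + v = 1"
  have "u *\<^sub>R x + v *\<^sub>R y \<in> K"
    using convexD[OF K xy uv] .
  moreover have v: "v = 1 - u" using uv by simp
  have "c + l ((u *\<^sub>R x + v *\<^sub>R y) - x0) = u * (c + l (x - x0)) + v * (c + l (y - x0))"
    unfolding v by (simp add: linear_add[OF l(1)] linear_diff[OF l(1)] linear_scale[OF l(1)] algebra_simps)
  ultimately show "zero_ext K (\<lambda>x. c + l (x - x0)) (u *\<^sub>R x + v *\<^sub>R y) =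
      u *\<^sub>R zero_ext K (\<lambda>x. c + l (x - x0)) x + v *\<^sub>R zero_ext K (\<lambda>x. c + l (x - x0)) y"
    using xy by (simp only: zero_ext_def if_True scaleR_conv_of_real of_real_mult of_real_add)
qed


section \<open>Strong dilations increase integrals of convex functions\<close>

text \<open>The density \<open>h\<close> of \<open>\<Phi> f\<close> dominates every affine minorant of \<open>f\<close> almost everywhere. The exceptional
  null sets depend on the minorant, so only finitely many minorants may be used at once; by
  compactness finitely many suffice to come within \<open>e\<close> of \<open>f\<close> on all of \<open>K\<close>. Hence \<open>h \<ge> f - e\<close> almost
  everywhere, and integration gives the inequality up to \<open>e \<mu>(K)\<close>.\<close>

lemma strong_dilation_le_imp_choquet_le:
  fixes K :: "'a::locally_convex_space set"
  assumes K: "convex K" and \<mu>: "compact_borel_measure \<mu> K" and \<nu>: "compact_borel_measure \<nu> K"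
    and strong: "strong_dilation_le K \<mu> \<nu>"
  shows "choquet_le K \<mu> \<nu>"
  unfolding choquet_le_def
proof (intro allI impI)
  interpret \<mu>: compact_borel_measure \<mu> K by fact
  interpret \<nu>: compact_borel_measure \<nu> K by fact
  fix f :: "'a \<Rightarrow> real" assume "continuous_on K f \<and> convex_on K f"
  then have f: "continuous_on K f" "convex_on K f" by auto
  obtain \<Phi> where \<Phi>: "positive_linear_map K \<mu> \<Phi>"
    and \<Phi>_affine: "\<And>a. a \<in> A_space K \<Longrightarrow> \<Phi> a = mult_op \<mu> a"
    and \<Phi>_\<nu>: "\<And>f. f \<in> C_space K \<Longrightarrow> (\<integral>x. f x \<partial>\<nu>) = L2_inner \<mu> (\<Phi> f (L2_one \<mu>)) (L2_one \<mu>)"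
    using strong by (auto simp: strong_dilation_le_def)
  have \<Phi>_add: "\<Phi> (\<lambda>x. f x + g x) = op_add \<mu> (\<Phi> f) (\<Phi> g)"
    if "f \<in> C_space K" "g \<in> C_space K" for f g
    using \<Phi> that by (simp add: positive_linear_map_def)
  have \<Phi>_scale: "\<Phi> (\<lambda>x. c * f x) = op_scale \<mu> c (\<Phi> f)" if "f \<in> C_space K" for f c
    using \<Phi> that by (simp add: positive_linear_map_def)
  have \<Phi>_pos: "op_positive \<mu> (\<Phi> f)" if "f \<in> C_space K" "\<forall>x\<in>K. f x \<in> \<real>\<^sub>\<ge>\<^sub>0" for f
    using \<Phi> that by (simp add: positive_linear_map_def)
  note fC = zero_ext_in_C_space[OF f(1)]
  have "\<Phi> (zero_ext K f) \<in> Linfty \<mu>"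
    using \<Phi> fC by (auto simp: positive_linear_map_def)
  then obtain h B where h: "\<Phi> (zero_ext K f) = mult_op \<mu> h" "h \<in> borel_measurable \<mu>"
      "AE x in \<mu>. cmod (h x) \<le> B"
    by (auto simp: Linfty_def)
  have h_int: "integrable \<mu> h"
    using h by (intro \<mu>.integrable_const_bound[of h B]) auto
  have h_ge_affine: "AE x in \<mu>. a x \<le> Re (h x)"
    if a: "zero_ext K a \<in> A_space K" "\<And>x. x \<in> K \<Longrightarrow> a x \<le> f x" for a
  proof -
    let ?a = "zero_ext K a"
    have aC: "?a \<in> C_space K"
      using a by (simp add: A_space_def)
    then have a_cont: "continuous_on K ?a"
      by (simp add: C_space_def)
    note a_meas = \<mu>.borel_measurable_continuous[OF a_cont]
    have aC': "(\<lambda>x. (- 1) * ?a x) \<in> C_space K"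
      using aC by (auto simp: C_space_def intro: continuous_intros)
    have dC: "(\<lambda>x. zero_ext K f x + (- 1) * ?a x) \<in> C_space K"
      using aC fC by (auto simp: C_space_def intro!: continuous_intros)
    have "\<Phi> (\<lambda>x. zero_ext K f x + (- 1) * ?a x) = op_add \<mu> (\<Phi> (zero_ext K f)) (\<Phi> (\<lambda>x. (- 1) * ?a x))"
      by (rule \<Phi>_add[OF fC aC'])
    also have "\<Phi> (\<lambda>x. (- 1) * ?a x) = op_scale \<mu> (- 1) (\<Phi> ?a)"
      by (rule \<Phi>_scale[OF aC])
    also have "op_add \<mu> (\<Phi> (zero_ext K f)) (op_scale \<mu> (- 1) (\<Phi> ?a)) = mult_op \<mu> (\<lambda>x. h x + (- 1) * ?a x)"
      unfolding h(1) \<Phi>_affine[OF a(1)] op_scale_mult_op[OF a_meas]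
      by (intro op_add_mult_op borel_measurable_times borel_measurable_const h(2) a_meas)
    finally have eq: "\<Phi> (\<lambda>x. zero_ext K f x + (- 1) * ?a x) = mult_op \<mu> (\<lambda>x. h x + (- 1) * ?a x)" .
    have "\<forall>x\<in>K. zero_ext K f x + (- 1) * ?a x \<in> \<real>\<^sub>\<ge>\<^sub>0"
      using a(2) by (simp add: zero_ext_def complex_nonneg_Reals_iff)
    then have "op_positive \<mu> (\<Phi> (\<lambda>x. zero_ext K f x + (- 1) * ?a x))"
      by (rule \<Phi>_pos[OF dC])
    then have "AE x in \<mu>. h x + (- 1) * ?a x \<in> \<real>\<^sub>\<ge>\<^sub>0"
      unfolding eq
      by (intro \<mu>.op_positive_mult_opD Bochner_Integration.integrable_add integrable_mult_right
          h_int \<mu>.integrable_continuous a_cont)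
    with AE_space show ?thesis
      by eventually_elim (auto simp: \<mu>.space_eq zero_ext_def complex_nonneg_Reals_iff)
  qed
  have approx: "(\<integral>x. f x \<partial>\<mu>) - e * measure \<mu> K \<le> (\<integral>x. f x \<partial>\<nu>)" if e: "0 < e" for e
  proof -
    \<comment> \<open>On \<open>W \<inter> K\<close> the minorant chosen at \<open>x0\<close> is within \<open>e\<close> of \<open>f\<close>.\<close>
    have "\<exists>W. open W \<and> x0 \<in> W \<and> (AE x in \<mu>. x \<in> W \<longrightarrow> f x - e \<le> Re (h x))" if x0: "x0 \<in> K" for x0
    proof -
      define c where "c = f x0 - e / 2"
      have c: "c < f x0" using e by (simp add: c_def)
      obtain l where l: "linear l" "continuous_on UNIV l" "\<And>y. y \<in> K \<Longrightarrow> c + l (y - x0) \<le> f y"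
        using exists_affine_below_convex[OF \<mu>.compact_K f x0 c] by blast
      have cont: "continuous_on K (\<lambda>x. c + l (x - x0))"
        by (intro continuous_intros continuous_on_compose2[OF l(2)]) auto
      have "continuous_on K (\<lambda>x. f x - (c + l (x - x0)))"
        by (intro continuous_intros f(1) cont)
      then obtain W where W: "open W" "W \<inter> K = (\<lambda>x. f x - (c + l (x - x0))) -` {..<e} \<inter> K"
        using open_lessThan[of e] unfolding continuous_on_open_invariant by blast
      have "x0 \<in> W \<inter> K"
        unfolding W(2) using x0 e linear_0[OF l(1)] by (simp add: c_def)
      moreover have "AE x in \<mu>. c + l (x - x0) \<le> Re (h x)"
        by (rule h_ge_affine[OF zero_ext_in_A_space[OF K l(1) cont] l(3)])
      with AE_space have "AE x in \<mu>. x \<in> W \<longrightarrow> f x - e \<le> Re (h x)"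
      proof eventually_elim
        case (elim x)
        have "f x - (c + l (x - x0)) < e" if "x \<in> W"
        proof -
          have "x \<in> W \<inter> K" using elim that by (simp add: \<mu>.space_eq)
          then show ?thesis unfolding W(2) by simp
        qed
        then show ?case using elim by auto
      qed
      ultimately show ?thesis
        using W(1) by blast
    qed
    then obtain W where W: "\<And>x. x \<in> K \<Longrightarrow> open (W x)" "\<And>x. x \<in> K \<Longrightarrow> x \<in> W x"
      "\<And>y. y \<in> K \<Longrightarrow> AE x in \<mu>. x \<in> W y \<longrightarrow> f x - e \<le> Re (h x)"
      by metis
    obtain T where T: "T \<subseteq> K" "finite T" "K \<subseteq> (\<Union>y\<in>T. W y)"
      using compactE_image[OF \<mu>.compact_K, of K W] W by blast
    have "AE x in \<mu>. \<forall>y\<in>T. x \<in> W y \<longrightarrow> f x - e \<le> Re (h x)"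
      using T(1,2) W(3) by (intro AE_finite_allI) auto
    with AE_space have "AE x in \<mu>. f x - e \<le> Re (h x)"
      by eventually_elim (use T(3) in \<open>auto simp: \<mu>.space_eq\<close>)
    then have "(\<integral>x. f x - e \<partial>\<mu>) \<le> (\<integral>x. Re (h x) \<partial>\<mu>)"
      by (intro integral_mono_AE Bochner_Integration.integrable_diff integrable_Re h_int
          \<mu>.integrable_continuous f(1)) auto
    also have "(\<integral>x. f x - e \<partial>\<mu>) = (\<integral>x. f x \<partial>\<mu>) - e * measure \<mu> K"
      using \<mu>.integrable_continuous[OF f(1)] by (simp add: \<mu>.space_eq mult.commute)
    also have "(\<integral>x. Re (h x) \<partial>\<mu>) = Re (\<integral>x. h x \<partial>\<mu>)"
      using h_int by simp
    also have "(\<integral>x. h x \<partial>\<mu>) = (\<integral>x. zero_ext K f x \<partial>\<nu>)"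
      unfolding \<Phi>_\<nu>[OF fC] h(1) by (rule \<mu>.L2_inner_mult_op_one[OF h(2), symmetric])
    also have "Re (\<integral>x. zero_ext K f x \<partial>\<nu>) = (\<integral>x. f x \<partial>\<nu>)"
      by (simp add: \<nu>.integral_zero_ext)
    finally show ?thesis .
  qed
  show "(\<integral>x. f x \<partial>\<mu>) \<le> (\<integral>x. f x \<partial>\<nu>)"
  proof (rule field_le_epsilon)
    fix d :: real assume d: "0 < d"
    define m where "m = measure \<mu> K"
    have m: "0 \<le> m" by (simp add: m_def)
    have "d / (m + 1) * m \<le> d"
      using d m by (simp add: field_simps)
    moreover have "(\<integral>x. f x \<partial>\<mu>) - d / (m + 1) * m \<le> (\<integral>x. f x \<partial>\<nu>)"
      unfolding m_def by (rule approx) (use d in \<open>simp add: add_nonneg_pos\<close>)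
    ultimately show "(\<integral>x. f x \<partial>\<mu>) \<le> (\<integral>x. f x \<partial>\<nu>) + d"
      by linarith
  qed
qed


section \<open>Bounded functions and their supremum\<close>

text \<open>All bounded functions on a set form a vector space of the kind that \<open>mazur_orlicz\<close> asks for: they are
  the bounded continuous functions for the discrete topology.\<close>

definition bounded_fun :: "('i \<Rightarrow> real) \<Rightarrow> 'i discrete \<Rightarrow>\<^sub>C real" where
  "bounded_fun F = Bcontfun (\<lambda>p. F (of_discrete p))"

lemma apply_bounded_fun:
  assumes "\<And>i. \<bar>F i\<bar> \<le> B"
  shows "apply_bcontfun (bounded_fun F) p = F (of_discrete p)"
proof -
  have "(\<lambda>p. F (of_discrete p)) \<in> bcontfun"
    unfolding bcontfun_def
    using assms by (auto simp: continuous_on_open_vimage open_discrete bounded_iff)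
  then show ?thesis
    by (simp add: bounded_fun_def Bcontfun_inverse)
qed

lemma bcontfun_le_SUP:
  fixes v :: "'i::topological_space \<Rightarrow>\<^sub>C real"
  shows "apply_bcontfun v p \<le> (SUP p. apply_bcontfun v p)"
  by (rule cSUP_upper) (auto intro: bounded_imp_bdd_above)

lemma sublinear_SUP:
  assumes C: "0 \<le> C"
  shows "sublinear (\<lambda>v :: 'i::topological_space \<Rightarrow>\<^sub>C real. C * (SUP p. apply_bcontfun v p))"
proof (rule sublinearI)
  fix v w :: "'i \<Rightarrow>\<^sub>C real" and t :: real
  have "(SUP p. apply_bcontfun (v + w) p) \<le> (SUP p. apply_bcontfun v p) + (SUP p. apply_bcontfun w p)"
    by (rule cSUP_least) (auto intro!: add_mono bcontfun_le_SUP)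
  then show "C * (SUP p. apply_bcontfun (v + w) p)
      \<le> C * (SUP p. apply_bcontfun v p) + C * (SUP p. apply_bcontfun w p)"
    using C by (simp add: mult_left_mono flip: distrib_left)
  assume t: "0 < t"
  have "(SUP p. apply_bcontfun (t *\<^sub>R v) p) \<le> t * (SUP p. apply_bcontfun v p)"
    using t by (intro cSUP_least) (auto intro!: mult_left_mono bcontfun_le_SUP)
  then show "C * (SUP p. apply_bcontfun (t *\<^sub>R v) p) \<le> t * (C * (SUP p. apply_bcontfun v p))"
    using C by (simp add: mult_left_mono mult.left_commute[of t])
qed


section \<open>The separation argument\<close>

text \<open>The pointwise maximum of finitely many functions, with an arbitrary convex function in its place
  when there are none.\<close>

lemma exists_continuous_convex_max:
  fixes I :: "('a::locally_convex_space \<Rightarrow> real) set"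
  assumes "finite I" "convex K" "\<And>h. h \<in> I \<Longrightarrow> continuous_on K h \<and> convex_on K h"
  shows "\<exists>g. continuous_on K g \<and> convex_on K g \<and> (\<forall>h\<in>I. \<forall>y. h y \<le> g y) \<and> (\<forall>y. I = {} \<or> (\<exists>h\<in>I. g y = h y))"
  using assms(1,3)
proof (induction I rule: finite_induct)
  case empty
  show ?case
    using assms(2) by (intro exI[of _ "\<lambda>_. 0"]) (simp add: convex_on_const)
next
  case (insert h I)
  then obtain g where g: "continuous_on K g" "convex_on K g" "\<forall>h\<in>I. \<forall>y. h y \<le> g y"
    "\<forall>y. I = {} \<or> (\<exists>h\<in>I. g y = h y)"
    by auto
  have h: "continuous_on K h" "convex_on K h"
    using insert by auto
  show ?case
  proof (cases "I = {}")
    case True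
    then show ?thesis using h by auto
  next
    case False
    have "convex_on K (\<lambda>y. max (h y) (g y))"
      unfolding convex_on_def
    proof (intro conjI ballI allI impI)
      fix x y and u v :: real assume xy: "x \<in> K" "y \<in> K" and uv: "0 \<le> u" "0 \<le> v" "u + v = 1"
      have "h (u *\<^sub>R x + v *\<^sub>R y) \<le> u * h x + v * h y" "g (u *\<^sub>R x + v *\<^sub>R y) \<le> u * g x + v * g y"
        using h(2) g(2) xy uv unfolding convex_on_def by blast+
      moreover have "u * h x + v * h y \<le> u * max (h x) (g x) + v * max (h y) (g y)"
        "u * g x + v * g y \<le> u * max (h x) (g x) + v * max (h y) (g y)"
        using uv by (auto intro!: add_mono mult_left_mono)
      ultimately show "max (h (u *\<^sub>R x + v *\<^sub>R y)) (g (u *\<^sub>R x + v *\<^sub>R y)) \<le> u * max (h x) (g x) + v * max (h y) (g y)"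
        by simp
    qed (rule assms(2))
    moreover have "\<forall>y. \<exists>k\<in>insert h I. max (h y) (g y) = k y"
      using g(4) False by (auto simp: max_def)
    moreover have "\<forall>k\<in>insert h I. \<forall>y. k y \<le> max (h y) (g y)"
      using g(3) by (auto simp: le_max_iff_disj)
    ultimately show ?thesis
      using h(1) g(1) by (intro exI[of _ "\<lambda>y. max (h y) (g y)"]) (auto intro: continuous_on_max)
  qed
qed

text \<open>Measurable choices, with finitely many values, of a continuous convex function \<open>H x\<close> for every \<open>x\<close>.\<close>

definition simple_convex :: "'a::{real_vector, topological_space} set \<Rightarrow> 'a measure \<Rightarrow> ('a \<Rightarrow> 'a \<Rightarrow> real) \<Rightarrow> bool" where
  "simple_convex K \<mu> H \<longleftrightarrow> simple_function \<mu> H \<and> (\<forall>x\<in>K. continuous_on K (H x) \<and> convex_on K (H x))"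

lemma simple_convex_add:
  assumes "simple_convex K \<mu> G" "simple_convex K \<mu> H"
  shows "simple_convex K \<mu> (\<lambda>x y. G x y + H x y)"
  using assms unfolding simple_convex_def
  by (auto intro: continuous_intros simple_function_compose2[of \<mu> G H "\<lambda>g h y. g y + h y"])

lemma simple_convex_scale:
  assumes "simple_convex K \<mu> H" "0 \<le> c"
  shows "simple_convex K \<mu> (\<lambda>x y. c * H x y)"
  using assms unfolding simple_convex_def
  by (auto intro: continuous_intros convex_on_cmul simple_function_compose1[of \<mu> H "\<lambda>h y. c * h y"])

lemma simple_convex_indicator:
  assumes "B \<in> sets \<mu>" "continuous_on K f" "convex_on K f"
  shows "simple_convex K \<mu> (\<lambda>x y. indicator B x * f y)"
  using assms unfolding simple_convex_def
  by (auto intro!: continuous_intros convex_on_cmul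
      simple_function_compose1[of \<mu> "indicator B" "\<lambda>r y. r * f y"] simple_function_indicator)

text \<open>The diagonal is glued from finitely many continuous functions along the measurable level sets of
  \<open>H\<close>.\<close>

lemma (in compact_borel_measure) integrable_diagonal:
  assumes "simple_function M H" "\<And>x. x \<in> K \<Longrightarrow> continuous_on K (H x)"
  shows "integrable M (\<lambda>x. H x x :: real)"
proof -
  let ?I = "H ` space M"
  have fin: "finite ?I"
    using assms(1) by (simp add: simple_function_def)
  have cont: "continuous_on K h" if "h \<in> ?I" for h
    using that assms(2) space_eq by auto
  have "H \<in> measurable M (count_space ?I)"
    using assms(1) by (subst measurable_count_space_eq2[OF fin]) (auto simp: simple_function_def)
  then have "(\<lambda>x. H x x) \<in> borel_measurable M"
    using fin cont
    by (intro measurable_compose_countable'[where f="\<lambda>h x. h x" and g=H and I="?I"])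
      (auto intro: borel_measurable_continuous countable_finite)
  moreover have "bounded (\<Union>h\<in>?I. h ` K)"
    using fin cont compact_K
    by (intro bounded_UN ballI compact_imp_bounded compact_continuous_image) auto
  then obtain B where "\<And>r. r \<in> (\<Union>h\<in>?I. h ` K) \<Longrightarrow> norm r \<le> B"
    unfolding bounded_iff by blast
  ultimately show ?thesis
    using space_eq by (intro integrable_bounded[of _ B]) auto
qed

text \<open>The only place where the Choquet order enters. The pointwise maximum \<open>g\<close> of the finitely many
  functions \<open>H x\<close> is continuous and convex, and \<open>H x x \<le> g x\<close> while \<open>g \<le> f + s\<close>, so
  \<open>\<integral>H x x d\<mu> \<le> \<mu>(g) \<le> \<nu>(g) \<le> \<nu>(f) + s \<nu>(K)\<close>.\<close>

lemma choquet_le_simple_convex: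
  fixes K :: "'a::locally_convex_space set"
  assumes K: "convex K" and \<mu>: "compact_borel_measure \<mu> K" and \<nu>: "compact_borel_measure \<nu> K"
    and le: "choquet_le K \<mu> \<nu>"
    and H: "simple_convex K \<mu> H" and f: "continuous_on K f"
    and Hf: "\<And>x y. x \<in> K \<Longrightarrow> y \<in> K \<Longrightarrow> H x y \<le> f y + s"
  shows "(\<integral>x. H x x \<partial>\<mu>) \<le> (\<integral>x. f x \<partial>\<nu>) + s * measure \<nu> K"
proof -
  interpret \<mu>: compact_borel_measure \<mu> K by fact
  interpret \<nu>: compact_borel_measure \<nu> K by fact
  have "finite (H ` K)"
    using H \<mu>.space_eq by (simp add: simple_convex_def simple_function_def)
  then obtain g where g: "continuous_on K g" "convex_on K g" "\<And>x y. x \<in> K \<Longrightarrow> H x y \<le> g y"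
    "\<And>y. y \<in> K \<Longrightarrow> \<exists>x\<in>K. g y = H x y"
  proof -
    have "continuous_on K h \<and> convex_on K h" if "h \<in> H ` K" for h
      using that H by (auto simp: simple_convex_def)
    from exists_continuous_convex_max[OF \<open>finite (H ` K)\<close> K this] obtain g
      where "continuous_on K g" "convex_on K g" "\<forall>h\<in>H ` K. \<forall>y. h y \<le> g y"
        "\<forall>y. H ` K = {} \<or> (\<exists>h\<in>H ` K. g y = h y)"
      by blast
    then show thesis
      using that[of g] by auto
  qed
  have "(\<integral>x. H x x \<partial>\<mu>) \<le> (\<integral>x. g x \<partial>\<mu>)"
    using H g(3) by (intro integral_mono \<mu>.integrable_diagonal \<mu>.integrable_continuous g(1))
      (auto simp: simple_convex_def \<mu>.space_eq)
  also have "\<dots> \<le> (\<integral>x. g x \<partial>\<nu>)"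
    using le g by (simp add: choquet_le_def)
  also have "\<dots> \<le> (\<integral>x. f x + s \<partial>\<nu>)"
    using g(4) Hf by (intro integral_mono \<nu>.integrable_continuous g(1) continuous_intros f)
      (force simp: \<nu>.space_eq)
  also have "\<dots> = (\<integral>x. f x \<partial>\<nu>) + s * measure \<nu> K"
    using \<nu>.integrable_continuous[OF f] by (simp add: \<nu>.space_eq mult.commute)
  finally show ?thesis .
qed

text \<open>The function \<open>1\<^sub>B \<otimes> f\<close> on \<open>K \<times> K\<close>.\<close>

definition tensor :: "'a set \<Rightarrow> 'a set \<Rightarrow> ('a \<Rightarrow> real) \<Rightarrow> ('a \<times> 'a) discrete \<Rightarrow>\<^sub>C real" where
  "tensor K B f = bounded_fun (\<lambda>(x, y). indicator B x * (indicator K y * f y))"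

lemma apply_tensor:
  fixes f :: "'a::topological_space \<Rightarrow> real"
  assumes "compact K" "continuous_on K f"
  shows "apply_bcontfun (tensor K B f) p =
    indicator B (fst (of_discrete p)) * (indicator K (snd (of_discrete p)) * f (snd (of_discrete p)))"
proof -
  have "bounded (f ` K)"
    using compact_continuous_image[OF assms(2,1)] by (rule compact_imp_bounded)
  then obtain C where C: "0 < C" "\<And>y. y \<in> K \<Longrightarrow> \<bar>f y\<bar> \<le> C"
    by (auto simp: bounded_pos)
  have "\<bar>case i of (x, y) \<Rightarrow> indicator B x * (indicator K y * f y)\<bar> \<le> C" for i
    using C(2) less_imp_le[OF C(1)] by (cases i) (auto simp: indicator_def)
  then show ?thesis
    unfolding tensor_def by (subst apply_bounded_fun[of _ C]) (auto simp: case_prod_beta)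
qed

text \<open>A dilation before its density is taken: \<open>\<beta> B f\<close> stands for the integral of \<open>\<Phi>(f)\<close> over \<open>B\<close>. Positivity
  and the values on affine functions are the defining properties of a dilation, integrated over \<open>B\<close>.\<close>

locale dilation_form = compact_borel_measure \<mu> K
  for \<mu> :: "'a::{real_vector, topological_space} measure" and K :: "'a set" +
  fixes \<beta> :: "'a set \<Rightarrow> ('a \<Rightarrow> real) \<Rightarrow> real"
  assumes convex_K: "convex K"
    and add_fun: "B \<in> sets \<mu> \<Longrightarrow> continuous_on K f \<Longrightarrow> continuous_on K g \<Longrightarrow>
      \<beta> B (\<lambda>x. f x + g x) = \<beta> B f + \<beta> B g"
    and scale_fun: "B \<in> sets \<mu> \<Longrightarrow> continuous_on K f \<Longrightarrow> \<beta> B (\<lambda>x. c * f x) = c * \<beta> B f"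
    and add_set: "B \<in> sets \<mu> \<Longrightarrow> C \<in> sets \<mu> \<Longrightarrow> B \<inter> C = {} \<Longrightarrow> continuous_on K f \<Longrightarrow>
      \<beta> (B \<union> C) f = \<beta> B f + \<beta> C f"
    and nonneg: "B \<in> sets \<mu> \<Longrightarrow> continuous_on K f \<Longrightarrow> (\<And>x. x \<in> K \<Longrightarrow> 0 \<le> f x) \<Longrightarrow> 0 \<le> \<beta> B f"
    and affine: "B \<in> sets \<mu> \<Longrightarrow> continuous_on K a \<Longrightarrow> convex_on K a \<Longrightarrow> concave_on K a \<Longrightarrow>
      \<beta> B a = set_lebesgue_integral \<mu> B a"

text \<open>A linear functional \<open>L\<close> on bounded functions of two variables is wanted with \<open>L (1\<^sub>K \<otimes> f) = \<nu>(f)\<close> and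
  \<open>L H \<ge> \<integral>H x x d\<mu>\<close> for simple convex \<open>H\<close>, and with \<open>L v \<le> \<nu>(K) sup v\<close>, which makes it positive.
  The constraints say that \<open>L\<close> maps \<open>1\<^sub>K \<otimes> f - H\<close> to at most \<open>\<nu>(f) - \<integral>H x x d\<mu>\<close>; these functions form a
  cone, and the compatibility with the supremum is precisely the preceding inequality. For affine \<open>f\<close>
  both \<open>1\<^sub>B \<otimes> f\<close> and its negative are simple convex, so \<open>L (1\<^sub>B \<otimes> f)\<close> is the integral of \<open>f\<close> over \<open>B\<close>.\<close>

lemma choquet_le_imp_dilation_form:
  fixes K :: "'a::locally_convex_space set"
  assumes K: "convex K" and \<mu>: "compact_borel_measure \<mu> K" and \<nu>: "compact_borel_measure \<nu> K"
    and le: "choquet_le K \<mu> \<nu>"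
  obtains \<beta> where "dilation_form \<mu> K \<beta>" "\<And>f. continuous_on K f \<Longrightarrow> \<beta> K f = (\<integral>x. f x \<partial>\<nu>)"
proof -
  interpret \<mu>: compact_borel_measure \<mu> K by fact
  interpret \<nu>: compact_borel_measure \<nu> K by fact
  define q where "q = (\<lambda>v :: ('a \<times> 'a) discrete \<Rightarrow>\<^sub>C real. measure \<nu> K * (SUP p. apply_bcontfun v p))"
  define D where "D = {(v :: ('a \<times> 'a) discrete \<Rightarrow>\<^sub>C real, r). \<exists>H f. simple_convex K \<mu> H \<and> continuous_on K f \<and>
    r = (\<integral>x. f x \<partial>\<nu>) - (\<integral>x. H x x \<partial>\<mu>) \<and>
    (\<forall>x\<in>K. \<forall>y\<in>K. apply_bcontfun v (discrete (x, y)) = f y - H x y)}"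
  have q: "sublinear q"
    unfolding q_def by (rule sublinear_SUP) simp
  have diag: "integrable \<mu> (\<lambda>x. H x x)" if "simple_convex K \<mu> H" for H
    using that by (intro \<mu>.integrable_diagonal) (auto simp: simple_convex_def)
  have zero: "simple_convex K \<mu> (\<lambda>_ _. 0)"
    using K by (auto simp: simple_convex_def convex_on_const)
  have D: "convex_cone D"
    unfolding convex_cone_iff
  proof (intro conjI ballI allI impI)
    show "0 \<in> D"
      unfolding D_def zero_prod_def mem_Collect_eq case_prod_conv
      by (intro exI[of _ "\<lambda>_ _. 0"] exI[of _ "\<lambda>_. 0"]) (use zero in simp)
  next
    fix d e assume "d \<in> D" "e \<in> D"
    then obtain v r H f w s G g where
      d: "d = (v, r)" "simple_convex K \<mu> H" "continuous_on K f" "r = (\<integral>x. f x \<partial>\<nu>) - (\<integral>x. H x x \<partial>\<mu>)"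
        "\<forall>x\<in>K. \<forall>y\<in>K. apply_bcontfun v (discrete (x, y)) = f y - H x y" and
      e: "e = (w, s)" "simple_convex K \<mu> G" "continuous_on K g" "s = (\<integral>x. g x \<partial>\<nu>) - (\<integral>x. G x x \<partial>\<mu>)"
        "\<forall>x\<in>K. \<forall>y\<in>K. apply_bcontfun w (discrete (x, y)) = g y - G x y"
      unfolding D_def by auto
    have "r + s = (\<integral>x. f x + g x \<partial>\<nu>) - (\<integral>x. H x x + G x x \<partial>\<mu>)"
      using d e by (simp add: diag \<nu>.integrable_continuous)
    then show "d + e \<in> D"
      unfolding D_def d(1) e(1) add_Pair mem_Collect_eq case_prod_conv
      by (intro exI[of _ "\<lambda>x y. H x y + G x y"] exI[of _ "\<lambda>x. f x + g x"])
        (use d(2,3,5) e(2,3,5) in \<open>auto intro: simple_convex_add continuous_intros\<close>)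
  next
    fix d and t :: real assume "d \<in> D" and t: "0 \<le> t"
    then obtain v r H f where
      d: "d = (v, r)" "simple_convex K \<mu> H" "continuous_on K f" "r = (\<integral>x. f x \<partial>\<nu>) - (\<integral>x. H x x \<partial>\<mu>)"
        "\<forall>x\<in>K. \<forall>y\<in>K. apply_bcontfun v (discrete (x, y)) = f y - H x y"
      unfolding D_def by auto
    have "t * r = (\<integral>x. t * f x \<partial>\<nu>) - (\<integral>x. t * H x x \<partial>\<mu>)"
      unfolding d(4) by (simp add: right_diff_distrib)
    then show "t *\<^sub>R d \<in> D"
      unfolding D_def d(1) scaleR_Pair mem_Collect_eq case_prod_conv
      by (intro exI[of _ "\<lambda>x y. t * H x y"] exI[of _ "\<lambda>x. t * f x"])
        (use d(2,3,5) t in \<open>auto intro: simple_convex_scale continuous_intros simp: right_diff_distrib\<close>)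
  qed
  have pos: "\<forall>(w, r)\<in>D. 0 \<le> r + q (- w)"
  proof clarify
    fix w r assume "(w, r) \<in> D"
    then obtain H f where
      d: "simple_convex K \<mu> H" "continuous_on K f" "r = (\<integral>x. f x \<partial>\<nu>) - (\<integral>x. H x x \<partial>\<mu>)"
        "\<forall>x\<in>K. \<forall>y\<in>K. apply_bcontfun w (discrete (x, y)) = f y - H x y"
      unfolding D_def by auto
    have "H x y \<le> f y + (SUP p. apply_bcontfun (- w) p)" if "x \<in> K" "y \<in> K" for x y
      using bcontfun_le_SUP[of "- w" "discrete (x, y)"] d(4) that by simp
    from choquet_le_simple_convex[OF K \<mu> \<nu> le d(1,2) this] show "0 \<le> r + q (- w)"
      unfolding q_def d(3) by (simp add: mult.commute)
  qed
  obtain L where L: "linear L" "\<And>v. L v \<le> q v" and LD: "\<And>w r. (w, r) \<in> D \<Longrightarrow> L w \<le> r"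
    using mazur_orlicz[OF q D pos] by blast
  define \<beta> where "\<beta> = (\<lambda>B f. L (tensor K B f))"
  note app = apply_tensor[OF \<mu>.compact_K]
  have scale: "\<beta> B (\<lambda>x. c * f x) = c * \<beta> B f" if "continuous_on K f" for B c and f :: "'a \<Rightarrow> real"
  proof -
    have "tensor K B (\<lambda>x. c * f x) = c *\<^sub>R tensor K B f"
      by (rule bcontfun_eqI) (use that in \<open>simp add: app continuous_intros\<close>)
    then show ?thesis
      by (simp add: \<beta>_def linear_scale[OF L(1)])
  qed
  have neg: "\<beta> B (\<lambda>x. - f x) = - \<beta> B f" if "continuous_on K f" for B and f :: "'a \<Rightarrow> real"
    using scale[OF that, of B "- 1"] by simp
  have nonpos: "\<beta> B f \<le> 0" if f: "continuous_on K f" "\<And>x. x \<in> K \<Longrightarrow> f x \<le> 0" for B f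
  proof -
    have "(SUP p. apply_bcontfun (tensor K B f) p) \<le> 0"
      by (rule cSUP_least) (use f in \<open>auto simp: app indicator_def\<close>)
    then have "q (tensor K B f) \<le> 0"
      unfolding q_def by (simp add: mult_nonneg_nonpos)
    then show ?thesis
      using L(2)[of "tensor K B f"] by (simp add: \<beta>_def)
  qed
  \<comment> \<open>The constraint with \<open>H = 1\<^sub>B \<otimes> f\<close> and the zero function in place of \<open>f\<close>.\<close>
  have convex_ge: "set_lebesgue_integral \<mu> B f \<le> \<beta> B f"
    if B: "B \<in> sets \<mu>" and f: "continuous_on K f" "convex_on K f" for B f
  proof -
    have "(tensor K B (\<lambda>x. - f x), (\<integral>x. 0 \<partial>\<nu>) - (\<integral>x. indicator B x * f x \<partial>\<mu>)) \<in> D"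
      unfolding D_def mem_Collect_eq case_prod_conv
      by (intro exI[of _ "\<lambda>x y. indicator B x * f y"] exI[of _ "\<lambda>_. 0"])
        (use simple_convex_indicator[OF B f] f in \<open>auto simp: app continuous_intros discrete_inverse\<close>)
    from LD[OF this] neg[OF f(1), of B] show ?thesis
      by (simp add: \<beta>_def set_lebesgue_integral_def)
  qed
  \<comment> \<open>The constraint with \<open>H = 0\<close>; applied to \<open>f\<close> and to \<open>- f\<close> it gives equality.\<close>
  have le_\<nu>: "\<beta> K f \<le> (\<integral>x. f x \<partial>\<nu>)" if f: "continuous_on K f" for f
  proof -
    have "(tensor K K f, (\<integral>x. f x \<partial>\<nu>) - (\<integral>x. 0 \<partial>\<mu>)) \<in> D"
      unfolding D_def mem_Collect_eq case_prod_conv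
      by (intro exI[of _ "\<lambda>_ _. 0"] exI[of _ f])
        (use zero f in \<open>auto simp: app discrete_inverse\<close>)
    from LD[OF this] show ?thesis
      by (simp add: \<beta>_def)
  qed
  show thesis
  proof (rule that)
    show "\<beta> K f = (\<integral>x. f x \<partial>\<nu>)" if f: "continuous_on K f" for f
      using le_\<nu>[OF f] le_\<nu>[of "\<lambda>x. - f x"] f neg[OF f] by (simp add: continuous_intros)
    show "dilation_form \<mu> K \<beta>"
    proof unfold_locales
      show "convex K" by (rule K)
    next
      fix B and f :: "'a \<Rightarrow> real" assume B: "B \<in> sets \<mu>" and f: "continuous_on K f"
      show "\<beta> B (\<lambda>x. c * f x) = c * \<beta> B f" for c
        by (rule scale[OF f])
      show "\<beta> B (\<lambda>x. f x + g x) = \<beta> B f + \<beta> B g" if g: "continuous_on K g" for g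
      proof -
        have "tensor K B (\<lambda>x. f x + g x) = tensor K B f + tensor K B g"
          by (rule bcontfun_eqI) (use f g in \<open>simp add: app continuous_intros distrib_left\<close>)
        then show ?thesis
          by (simp add: \<beta>_def linear_add[OF L(1)])
      qed
      show "\<beta> (B \<union> C) f = \<beta> B f + \<beta> C f" if "B \<inter> C = {}" for C
      proof -
        have "tensor K (B \<union> C) f = tensor K B f + tensor K C f"
          by (rule bcontfun_eqI) (use f that in \<open>auto simp: app indicator_def\<close>)
        then show ?thesis
          by (simp add: \<beta>_def linear_add[OF L(1)])
      qed
      show "0 \<le> \<beta> B f" if "\<And>x. x \<in> K \<Longrightarrow> 0 \<le> f x"
        using nonpos[of "\<lambda>x. - f x" B] that f neg[OF f] by (simp add: continuous_intros)
      show "\<beta> B f = set_lebesgue_integral \<mu> B f" if "convex_on K f" "concave_on K f"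
        using convex_ge[OF B f that(1)] convex_ge[OF B, of "\<lambda>x. - f x"] that(2) f neg[OF f, of B]
        by (simp add: concave_on_def continuous_intros set_lebesgue_integral_def)
    qed
  qed
qed


section \<open>Densities\<close>

text \<open>Domination by a measure turns finite additivity into continuity at the empty set, hence into
  countable additivity and absolute continuity, and the Radon--Nikodym theorem applies.\<close>

lemma (in finite_measure) exists_density_of_dominated_additive:
  fixes m :: "'a set \<Rightarrow> real"
  assumes add: "\<And>A B. A \<in> sets M \<Longrightarrow> B \<in> sets M \<Longrightarrow> A \<inter> B = {} \<Longrightarrow> m (A \<union> B) = m A + m B"
    and nonneg: "\<And>B. B \<in> sets M \<Longrightarrow> 0 \<le> m B"
    and le: "\<And>B. B \<in> sets M \<Longrightarrow> m B \<le> C * measure M B"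
  obtains h where "integrable M h" "AE x in M. 0 \<le> h x \<and> h x \<le> C"
    "\<And>B. B \<in> sets M \<Longrightarrow> set_lebesgue_integral M B h = m B"
proof -
  let ?m = "\<lambda>B. ennreal (m B)"
  have m0: "m {} = 0"
    using le[of "{}"] nonneg[of "{}"] by simp
  have pos: "positive (sets M) ?m"
    by (simp add: positive_def m0)
  have ca: "countably_additive (sets M) ?m"
  proof (rule sets.empty_continuous_imp_countably_additive[OF pos])
    show "additive (sets M) ?m"
      by (auto simp: additive_def add nonneg ennreal_plus)
    fix A :: "nat \<Rightarrow> 'a set" assume A: "range A \<subseteq> sets M" "decseq A" "(\<Inter>i. A i) = {}"
    have "(\<lambda>i. C * measure M (A i)) \<longlonglongrightarrow> C * 0"
      using finite_Lim_measure_decseq[OF A(1,2)] A(3) by (intro tendsto_intros) simp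
    then have lim: "(\<lambda>i. C * measure M (A i)) \<longlonglongrightarrow> 0"
      by simp
    have A_sets: "A i \<in> sets M" for i
      using A(1) by auto
    have "(\<lambda>i. m (A i)) \<longlonglongrightarrow> 0"
      by (rule tendsto_sandwich[OF always_eventually always_eventually tendsto_const lim])
        (simp_all add: A_sets le nonneg)
    then show "(\<lambda>i. ?m (A i)) \<longlonglongrightarrow> 0"
      using tendsto_ennrealI by fastforce
  qed auto
  define N where "N = measure_of (space M) (sets M) ?m"
  have sets_N: "sets N = sets M"
    by (simp add: N_def)
  have N: "emeasure N B = ?m B" if "B \<in> sets M" for B
    unfolding N_def by (rule emeasure_measure_of_sigma[OF sets.sigma_algebra_axioms pos ca that])
  have "absolutely_continuous M N"
    unfolding absolutely_continuous_def
  proof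
    fix B assume "B \<in> null_sets M"
    then show "B \<in> null_sets N"
      using le[of B] nonneg[of B] sets_N by (auto simp: null_sets_def N measure_def)
  qed
  then obtain g where g[measurable]: "g \<in> borel_measurable M" and gN: "density M g = N"
    using Radon_Nikodym sets_N by blast
  define h where "h x = enn2real (g x)" for x
  have [measurable]: "h \<in> borel_measurable M"
    unfolding h_def by measurable
  have "(\<integral>\<^sup>+x. g x \<partial>M) = (\<integral>\<^sup>+x. g x * indicator (space M) x \<partial>M)"
    by (rule nn_integral_cong) simp
  also have "\<dots> = ?m (space M)"
    using N[of "space M"] by (simp add: emeasure_density flip: gN)
  finally have "AE x in M. g x \<noteq> \<infinity>"
    by (intro nn_integral_PInf_AE) auto
  then have gh: "AE x in M. g x = ennreal (h x)"
    by eventually_elim (simp add: h_def less_top)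
  have nn: "(\<integral>\<^sup>+x. ennreal (indicator B x * h x) \<partial>M) = ?m B" if [measurable]: "B \<in> sets M" for B
  proof -
    have "(\<integral>\<^sup>+x. ennreal (indicator B x * h x) \<partial>M) = (\<integral>\<^sup>+x. g x * indicator B x \<partial>M)"
      by (rule nn_integral_cong_AE) (use gh in eventually_elim, auto simp: indicator_def)
    then show ?thesis
      using N[OF that] by (simp add: emeasure_density flip: gN)
  qed
  have h_nonneg: "0 \<le> h x" for x
    by (simp add: h_def)
  have int: "set_lebesgue_integral M B h = m B" if [measurable]: "B \<in> sets M" for B
  proof -
    have "(\<integral>x. indicator B x * h x \<partial>M) = enn2real (\<integral>\<^sup>+x. ennreal (indicator B x * h x) \<partial>M)"
      by (rule integral_eq_nn_integral) (simp_all add: h_nonneg)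
    then show ?thesis
      by (simp add: set_lebesgue_integral_def nn[OF that] nonneg[OF that])
  qed
  have h_int: "integrable M h"
  proof (rule integrableI_nonneg)
    have "(\<integral>\<^sup>+x. ennreal (h x) \<partial>M) = (\<integral>\<^sup>+x. ennreal (indicator (space M) x * h x) \<partial>M)"
      by (rule nn_integral_cong) simp
    then show "(\<integral>\<^sup>+x. ennreal (h x) \<partial>M) < \<infinity>"
      by (simp add: nn)
  qed (simp_all add: h_nonneg)
  have "AE x in M. h x \<in> {0..C}"
  proof (rule averaging_theorem[OF h_int])
    fix A assume A: "A \<in> sets M" "0 < measure M A"
    then show "(1 / measure M A) *\<^sub>R set_lebesgue_integral M A h \<in> {0..C}"
      using nonneg[OF A(1)] le[OF A(1)] by (simp add: int pos_divide_le_eq)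
  qed simp
  then show thesis
    by (intro that[of h] h_int int) auto
qed

context dilation_form
begin

lemma form_const: "B \<in> sets \<mu> \<Longrightarrow> \<beta> B (\<lambda>_. c) = c * measure \<mu> B"
  using affine[of B "\<lambda>_. c"] convex_K
  by (simp add: convex_on_const concave_on_const set_integral_const less_top)

lemma form_le:
  assumes B: "B \<in> sets \<mu>" and f: "continuous_on K f" "\<And>x. x \<in> K \<Longrightarrow> f x \<le> C"
  shows "\<beta> B f \<le> C * measure \<mu> B"
proof -
  have cont: "continuous_on K (\<lambda>x. (- 1) * f x)"
    by (intro continuous_intros f(1))
  have "0 \<le> \<beta> B (\<lambda>x. C + (- 1) * f x)"
    using f by (intro nonneg B continuous_intros) auto
  also have "\<dots> = C * measure \<mu> B - \<beta> B f"
    unfolding add_fun[OF B continuous_on_const cont] scale_fun[OF B f(1)] form_const[OF B] by simp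
  finally show ?thesis by simp
qed

text \<open>Adding a constant reduces the claim to a nonnegative function; the form of a constant is a multiple
  of \<open>\<mu>\<close>, so its density is that constant.\<close>

lemma exists_form_density:
  assumes f: "continuous_on K f"
  shows "\<exists>h. integrable \<mu> h \<and> (\<exists>C. AE x in \<mu>. \<bar>h x\<bar> \<le> C) \<and>
    (\<forall>B\<in>sets \<mu>. set_lebesgue_integral \<mu> B h = \<beta> B f)"
proof -
  obtain C where C: "0 \<le> C" "\<And>x. x \<in> K \<Longrightarrow> norm (f x) \<le> C"
    using continuous_bounded[OF f] by blast
  have bound: "0 \<le> f x + C" "f x + C \<le> 2 * C" if "x \<in> K" for x
    using C(2)[OF that] by auto
  have cont: "continuous_on K (\<lambda>x. f x + C)"
    by (intro continuous_intros f)
  have shift: "\<beta> B (\<lambda>x. f x + C) = \<beta> B f + C * measure \<mu> B" if "B \<in> sets \<mu>" for B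
    using add_fun[OF that f continuous_on_const] form_const[OF that] by simp
  obtain h where h: "integrable \<mu> h" "AE x in \<mu>. 0 \<le> h x \<and> h x \<le> 2 * C"
    "\<And>B. B \<in> sets \<mu> \<Longrightarrow> set_lebesgue_integral \<mu> B h = \<beta> B (\<lambda>x. f x + C)"
  proof (rule exists_density_of_dominated_additive[of "\<lambda>B. \<beta> B (\<lambda>x. f x + C)" "2 * C"])
    show "0 \<le> \<beta> B (\<lambda>x. f x + C)" if "B \<in> sets \<mu>" for B
      using bound by (intro nonneg that cont) auto
    show "\<beta> B (\<lambda>x. f x + C) \<le> 2 * C * measure \<mu> B" if "B \<in> sets \<mu>" for B
      using bound by (intro form_le that cont) auto
  qed (auto intro: add_set cont)
  have "AE x in \<mu>. \<bar>h x - C\<bar> \<le> C"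
    using h(2) by eventually_elim auto
  moreover have "set_lebesgue_integral \<mu> B (\<lambda>x. h x - C) = \<beta> B f" if B: "B \<in> sets \<mu>" for B
  proof -
    have "set_integrable \<mu> B h" "set_integrable \<mu> B (\<lambda>_. C)"
      unfolding set_integrable_def by (intro integrable_mult_indicator integrable_const B h(1))+
    then have "set_lebesgue_integral \<mu> B (\<lambda>x. h x - C) = \<beta> B (\<lambda>x. f x + C) - measure \<mu> B * C"
      using B by (simp add: h(3) set_integral_const less_top)
    then show ?thesis
      using shift[OF B] by simp
  qed
  ultimately show ?thesis
    using h(1) by (intro exI[of _ "\<lambda>x. h x - C"]) auto
qed

definition complex_form :: "'a set \<Rightarrow> ('a \<Rightarrow> complex) \<Rightarrow> complex" where
  "complex_form B f = Complex (\<beta> B (\<lambda>x. Re (f x))) (\<beta> B (\<lambda>x. Im (f x)))"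

lemma set_integral_Complex:
  fixes g :: "'a \<Rightarrow> complex"
  assumes "integrable \<mu> g" "B \<in> sets \<mu>"
  shows "set_lebesgue_integral \<mu> B g =
    Complex (set_lebesgue_integral \<mu> B (\<lambda>x. Re (g x))) (set_lebesgue_integral \<mu> B (\<lambda>x. Im (g x)))"
  using integrable_mult_indicator[OF assms(2,1)]
  by (simp add: set_lebesgue_integral_def complex_eq_iff flip: integral_Re integral_Im)

lemma exists_complex_density:
  assumes f: "continuous_on K f"
  shows "\<exists>h. integrable \<mu> h \<and> (\<exists>C. AE x in \<mu>. cmod (h x) \<le> C) \<and>
    (\<forall>B\<in>sets \<mu>. set_lebesgue_integral \<mu> B h = complex_form B f)"
proof -
  obtain u C where u: "integrable \<mu> u" "AE x in \<mu>. \<bar>u x\<bar> \<le> C"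
    "\<And>B. B \<in> sets \<mu> \<Longrightarrow> set_lebesgue_integral \<mu> B u = \<beta> B (\<lambda>x. Re (f x))"
    using exists_form_density[of "\<lambda>x. Re (f x)"] f by (auto intro: continuous_intros)
  obtain v D where v: "integrable \<mu> v" "AE x in \<mu>. \<bar>v x\<bar> \<le> D"
    "\<And>B. B \<in> sets \<mu> \<Longrightarrow> set_lebesgue_integral \<mu> B v = \<beta> B (\<lambda>x. Im (f x))"
    using exists_form_density[of "\<lambda>x. Im (f x)"] f by (auto intro: continuous_intros)
  have int: "integrable \<mu> (\<lambda>x. Complex (u x) (v x))"
    unfolding Complex_eq using u(1) v(1) by (auto intro!: integrable_mult_right)
  have bound: "AE x in \<mu>. cmod (Complex (u x) (v x)) \<le> C + D"
    using u(2) v(2) by eventually_elim (rule order_trans[OF cmod_le], simp)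
  show ?thesis
  proof (intro exI conjI ballI)
    fix B assume B: "B \<in> sets \<mu>"
    show "set_lebesgue_integral \<mu> B (\<lambda>x. Complex (u x) (v x)) = complex_form B f"
      using set_integral_Complex[OF int B] by (simp add: complex_form_def u(3)[OF B] v(3)[OF B])
  qed (rule int bound)+
qed

lemma complex_form_add:
  assumes "B \<in> sets \<mu>" "continuous_on K f" "continuous_on K g"
  shows "complex_form B (\<lambda>x. f x + g x) = complex_form B f + complex_form B g"
  using assms by (simp add: complex_form_def complex_eq_iff add_fun continuous_intros)

lemma complex_form_scale:
  assumes B: "B \<in> sets \<mu>" and f: "continuous_on K f"
  shows "complex_form B (\<lambda>x. c * f x) = c * complex_form B f"
proof -
  have cont: "continuous_on K (\<lambda>x. Re (f x))" "continuous_on K (\<lambda>x. Im (f x))"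
    using f by (auto intro: continuous_intros)
  have lin: "\<beta> B (\<lambda>x. a * Re (f x) + b * Im (f x)) = a * \<beta> B (\<lambda>x. Re (f x)) + b * \<beta> B (\<lambda>x. Im (f x))" for a b
    using cont by (simp add: add_fun[OF B] scale_fun[OF B] continuous_intros)
  show ?thesis
    using lin[of "Re c" "- Im c"] lin[of "Im c" "Re c"]
    by (simp add: complex_form_def complex_eq_iff add.commute)
qed

lemma complex_form_nonneg:
  assumes B: "B \<in> sets \<mu>" and f: "f \<in> C_space K" "\<And>x. x \<in> K \<Longrightarrow> f x \<in> \<real>\<^sub>\<ge>\<^sub>0"
  shows "complex_form B f \<in> \<real>\<^sub>\<ge>\<^sub>0"
proof -
  have "Im (f x) = 0" for x
    using f by (cases "x \<in> K") (auto simp: C_space_def complex_nonneg_Reals_iff)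
  then have "\<beta> B (\<lambda>x. Im (f x)) = 0"
    using form_const[OF B, of 0] by simp
  moreover have "0 \<le> \<beta> B (\<lambda>x. Re (f x))"
    using f by (intro nonneg[OF B]) (auto simp: C_space_def complex_nonneg_Reals_iff intro: continuous_intros)
  ultimately show ?thesis
    by (simp add: complex_form_def complex_nonneg_Reals_iff)
qed

lemma complex_form_affine:
  assumes B: "B \<in> sets \<mu>" and a: "a \<in> A_space K"
  shows "complex_form B a = set_lebesgue_integral \<mu> B a"
proof -
  have cont: "continuous_on K a"
    using a by (simp add: A_space_def C_space_def)
  have aff: "a (u *\<^sub>R x + v *\<^sub>R y) = u *\<^sub>R a x + v *\<^sub>R a y"
    if "x \<in> K" "y \<in> K" "0 \<le> u" "0 \<le> v" "u + v = 1" for x y u v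
    using a that by (simp add: A_space_def)
  have "convex_on K (\<lambda>x. Re (a x))" "concave_on K (\<lambda>x. Re (a x))"
    "convex_on K (\<lambda>x. Im (a x))" "concave_on K (\<lambda>x. Im (a x))"
    unfolding convex_on_def concave_on_iff using convex_K by (auto simp: aff)
  then show ?thesis
    using cont set_integral_Complex[OF integrable_continuous[OF cont] B]
    by (simp add: complex_form_def affine[OF B] continuous_intros)
qed

text \<open>Densities are chosen separately for every \<open>f\<close>. Linearity and the values on \<open>A_space K\<close> are recovered
  from the uniqueness of densities up to null sets, positivity from the averages of the density.\<close>

lemma exists_positive_linear_map:
  obtains \<Phi> where "positive_linear_map K \<mu> \<Phi>" "\<And>a. a \<in> A_space K \<Longrightarrow> \<Phi> a = mult_op \<mu> a"
    "\<And>f. f \<in> C_space K \<Longrightarrow> L2_inner \<mu> (\<Phi> f (L2_one \<mu>)) (L2_one \<mu>) = complex_form K f"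
proof -
  have C_cont: "continuous_on K f" if "f \<in> C_space K" for f
    using that by (simp add: C_space_def)
  have "\<exists>h. \<forall>f\<in>C_space K. integrable \<mu> (h f) \<and> (\<exists>C. AE x in \<mu>. cmod (h f x) \<le> C) \<and>
    (\<forall>B\<in>sets \<mu>. set_lebesgue_integral \<mu> B (h f) = complex_form B f)"
    by (intro bchoice ballI exists_complex_density C_cont)
  then obtain h where int: "\<And>f. f \<in> C_space K \<Longrightarrow> integrable \<mu> (h f)"
    and bound: "\<And>f. f \<in> C_space K \<Longrightarrow> \<exists>C. AE x in \<mu>. cmod (h f x) \<le> C"
    and form: "\<And>f B. f \<in> C_space K \<Longrightarrow> B \<in> sets \<mu> \<Longrightarrow> set_lebesgue_integral \<mu> B (h f) = complex_form B f"
    by blast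
  have meas: "h f \<in> borel_measurable \<mu>" if "f \<in> C_space K" for f
    using int[OF that] by (rule borel_measurable_integrable)
  have uniq: "mult_op \<mu> (h f) = mult_op \<mu> g"
    if "f \<in> C_space K" "integrable \<mu> g"
      "\<And>B. B \<in> sets \<mu> \<Longrightarrow> set_lebesgue_integral \<mu> B g = complex_form B f" for f g
    using that by (intro mult_op_cong_AE density_unique_banach int) (simp_all add: form)
  have set_int: "set_integrable \<mu> B (h f)" if "B \<in> sets \<mu>" "f \<in> C_space K" for B f
    unfolding set_integrable_def using that by (intro integrable_mult_indicator int)
  define \<Phi> where "\<Phi> = (\<lambda>f. mult_op \<mu> (h f))"
  show thesis
  proof (rule that[of \<Phi>])
    show "positive_linear_map K \<mu> \<Phi>"
      unfolding positive_linear_map_def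
    proof (intro conjI ballI allI impI)
      show "\<Phi> \<in> C_space K \<rightarrow> Linfty \<mu>"
        using meas bound by (auto simp: \<Phi>_def Linfty_def)
    next
      fix f g assume f: "f \<in> C_space K" and g: "g \<in> C_space K"
      have fg: "(\<lambda>x. f x + g x) \<in> C_space K"
        using f g by (auto simp: C_space_def intro: continuous_intros)
      have "mult_op \<mu> (h (\<lambda>x. f x + g x)) = mult_op \<mu> (\<lambda>x. h f x + h g x)"
        using f g by (intro uniq fg Bochner_Integration.integrable_add int)
          (simp_all add: set_int form complex_form_add C_cont)
      then show "\<Phi> (\<lambda>x. f x + g x) = op_add \<mu> (\<Phi> f) (\<Phi> g)"
        unfolding \<Phi>_def by (simp add: op_add_mult_op[OF meas[OF f] meas[OF g]])
    next
      fix c f assume f: "f \<in> C_space K"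
      have cf: "(\<lambda>x. c * f x) \<in> C_space K"
        using f by (auto simp: C_space_def intro: continuous_intros)
      have "mult_op \<mu> (h (\<lambda>x. c * f x)) = mult_op \<mu> (\<lambda>x. c * h f x)"
        using f by (intro uniq cf integrable_mult_right int)
          (simp_all add: form complex_form_scale C_cont)
      then show "\<Phi> (\<lambda>x. c * f x) = op_scale \<mu> c (\<Phi> f)"
        unfolding \<Phi>_def by (simp add: op_scale_mult_op[OF meas[OF f]])
    next
      fix f assume f: "f \<in> C_space K" "\<forall>x\<in>K. f x \<in> \<real>\<^sub>\<ge>\<^sub>0"
      have "AE x in \<mu>. h f x \<in> \<real>\<^sub>\<ge>\<^sub>0"
      proof (rule averaging_theorem[OF int[OF f(1)] closed_nonneg_Reals_complex])
        fix B assume B: "B \<in> sets \<mu>"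
        show "(1 / measure \<mu> B) *\<^sub>R set_lebesgue_integral \<mu> B (h f) \<in> \<real>\<^sub>\<ge>\<^sub>0"
          using complex_form_nonneg[OF B f(1)] f(2) by (simp add: form[OF f(1) B] complex_nonneg_Reals_iff)
      qed
      then show "op_positive \<mu> (\<Phi> f)"
        unfolding \<Phi>_def by (rule op_positive_mult_opI[OF meas[OF f(1)]])
    qed
    show "\<Phi> a = mult_op \<mu> a" if a: "a \<in> A_space K" for a
    proof -
      have aC: "a \<in> C_space K"
        using a by (simp add: A_space_def)
      show ?thesis
        unfolding \<Phi>_def
        by (rule uniq[OF aC integrable_continuous[OF C_cont[OF aC]]]) (simp add: complex_form_affine a)
    qed
    show "L2_inner \<mu> (\<Phi> f (L2_one \<mu>)) (L2_one \<mu>) = complex_form K f" if f: "f \<in> C_space K" for f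
    proof -
      have "L2_inner \<mu> (\<Phi> f (L2_one \<mu>)) (L2_one \<mu>) = (\<integral>x. h f x \<partial>\<mu>)"
        unfolding \<Phi>_def by (rule L2_inner_mult_op_one[OF meas[OF f]])
      also have "\<dots> = set_lebesgue_integral \<mu> (space \<mu>) (h f)"
        using set_integral_space[OF int[OF f]] by simp
      also have "\<dots> = complex_form K f"
        using form[OF f sets.top] by (simp add: space_eq)
      finally show ?thesis .
    qed
  qed
qed

end

lemma choquet_le_imp_strong_dilation_le:
  fixes K :: "'a::locally_convex_space set"
  assumes K: "convex K" and \<mu>: "compact_borel_measure \<mu> K" and \<nu>: "compact_borel_measure \<nu> K"
    and le: "choquet_le K \<mu> \<nu>"
  shows "strong_dilation_le K \<mu> \<nu>"
proof -
  interpret \<nu>: compact_borel_measure \<nu> K by fact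
  obtain \<beta> where "dilation_form \<mu> K \<beta>" and \<beta>: "\<And>f. continuous_on K f \<Longrightarrow> \<beta> K f = (\<integral>x. f x \<partial>\<nu>)"
    using choquet_le_imp_dilation_form[OF K \<mu> \<nu> le] by blast
  then interpret dilation_form \<mu> K \<beta> by simp
  obtain \<Phi> where \<Phi>: "positive_linear_map K \<mu> \<Phi>" "\<And>a. a \<in> A_space K \<Longrightarrow> \<Phi> a = mult_op \<mu> a"
    "\<And>f. f \<in> C_space K \<Longrightarrow> L2_inner \<mu> (\<Phi> f (L2_one \<mu>)) (L2_one \<mu>) = complex_form K f"
    using exists_positive_linear_map by blast
  have "complex_form K f = (\<integral>x. f x \<partial>\<nu>)" if "f \<in> C_space K" for f
  proof -
    have f: "continuous_on K f"
      using that by (simp add: C_space_def)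
    then show ?thesis
      using \<nu>.integrable_continuous[OF f]
      by (simp add: complex_form_def \<beta> continuous_intros complex_eq_iff flip: integral_Re integral_Im)
  qed
  with \<Phi> show ?thesis
    unfolding strong_dilation_le_def by auto
qed

theorem theorem3p7:
  fixes K :: "'a::locally_convex_space set" and \<mu> \<nu> :: "'a measure"
  assumes "compact K" and "convex K"
    and "\<mu> \<in> regular_borel_measures K" and "\<nu> \<in> regular_borel_measures K"
  shows "choquet_le K \<mu> \<nu> \<longleftrightarrow> strong_dilation_le K \<mu> \<nu>"
proof -
  note \<mu> = compact_borel_measureI[OF assms(1,3)] and \<nu> = compact_borel_measureI[OF assms(1,4)]
  show ?thesis
    using choquet_le_imp_strong_dilation_le[OF assms(2) \<mu> \<nu>]
      strong_dilation_le_imp_choquet_le[OF assms(2) \<mu> \<nu>] by blast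
qed

end
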